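(* Let $d\ge2$. For any $\alpha\in(0,d-1)$ and $Q>0$, the functional $\mathcal F_{\alpha,Q}$ does not admit local volume-constrained minimizers with respect to the $L^1$ topology, nor with respect to the Hausdorff topology. That is, there is no compact set $E\subset\mathbb R^d$ with $|E|>0$ which is a local volume-constrained minimizer of $\mathcal F_{\alpha,Q}$ in either of these topologies.
   Context: $|E|$ is Lebesgue measure in $\mathbb R^d$. $P(E)$ is the perimeter of $E$ in $\mathbb R^d$ in the sense of De Giorgi (equal to $\mathcal H^{d-1}(\partial E)$ when $E$ has smooth boundary). For $\alpha\in(0,d)$ and $E$ compact, the Riesz potential energy is $$\mathcal I_\alpha(E)=\inf\left\{\int_{\mathbb R^d\times\mathbb R^d}\frac{d\mu(x)\,d\mu(y)}{|x-y|^\alpha}:\ \mu \text{ non-negative Borel measure on }\mathbb R^d,\ \mu(E)=1\right\},$$ and $\mathcal F_{\alpha,Q}(E)=P(E)+Q^2\,\mathcal I_\alpha(E)$. A compact set $E$ is a local volume-constrained minimizer of $\mathcal F_{\alpha,Q}$ with respect to the $L^1$ (resp. Hausdorff) topology if there is $\varepsilon>0$ such that $\mathcal F_{\alpha,Q}(E)\le\mathcal F_{\alpha,Q}(F)$ for every compact set $F$ with $|F|=|E|$ and $|E\Delta F|\le\varepsilon$ (resp. with Hausdorff distance between $E$ and $F$ at most $\varepsilon$). *)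

theory Defs
  imports "HOL-Analysis.Analysis"
begin

definition divergence :: "('a::euclidean_space \<Rightarrow> 'a) \<Rightarrow> 'a \<Rightarrow> real" where
  "divergence \<phi> x = (\<Sum>i\<in>Basis. frechet_derivative \<phi> (at x) i \<bullet> i)"

definition C1c_fields :: "('a::euclidean_space \<Rightarrow> 'a) set" where
  "C1c_fields = {\<phi>. compact (closure {x. \<phi> x \<noteq> 0}) \<and>
     (\<exists>\<phi>' :: 'a \<Rightarrow> 'a \<Rightarrow>\<^sub>L 'a. continuous_on UNIV \<phi>' \<and>
        (\<forall>x. (\<phi> has_derivative blinfun_apply (\<phi>' x)) (at x)))}"

(* De Giorgi perimeter. The truncation of negative reals by ennreal does not affect the
   supremum, since the zero field is admissible. *)
definition perimeter :: "'a::euclidean_space set \<Rightarrow> ennreal" where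
  "perimeter E = (SUP \<phi> \<in> {\<phi> \<in> C1c_fields. \<forall>x. norm (\<phi> x) \<le> 1}.
     ennreal (LINT x:E|lebesgue. divergence \<phi> x))"

(* The division takes place in ennreal, so that the kernel is infinite on the diagonal
   (for \<alpha> > 0); with real division it would be 0 there. The double integral is written as
   an iterated one because \<mu> need not be sigma-finite away from E, in which case the
   library's product measure \<mu> \<Otimes>\<^sub>M \<mu> is not meaningful; for sigma-finite \<mu> the two agree. *)
definition riesz_energy :: "real \<Rightarrow> 'a::euclidean_space set \<Rightarrow> ennreal" where
  "riesz_energy \<alpha> E = (INF \<mu> \<in> {\<mu> :: 'a measure. sets \<mu> = sets borel \<and> emeasure \<mu> E = 1}.
     \<integral>\<^sup>+ y. (\<integral>\<^sup>+ x. 1 / ennreal (dist x y powr \<alpha>) \<partial>\<mu>) \<partial>\<mu>)"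

definition charged_energy :: "real \<Rightarrow> real \<Rightarrow> 'a::euclidean_space set \<Rightarrow> ennreal" where
  "charged_energy \<alpha> Q E = perimeter E + ennreal (Q\<^sup>2) * riesz_energy \<alpha> E"

(* Extended-valued: the distance between the empty set and a nonempty set is infinite. *)
definition hausdorff_distance :: "'a::metric_space set \<Rightarrow> 'a set \<Rightarrow> ennreal" where
  "hausdorff_distance E F =
     max (SUP x\<in>E. INF y\<in>F. ennreal (dist x y)) (SUP y\<in>F. INF x\<in>E. ennreal (dist x y))"

definition L1_local_minimizer :: "real \<Rightarrow> real \<Rightarrow> 'a::euclidean_space set \<Rightarrow> bool" where
  "L1_local_minimizer \<alpha> Q E \<longleftrightarrow> compact E \<and>
     (\<exists>\<epsilon>>0. \<forall>F. compact F \<and> measure lebesgue F = measure lebesgue E \<and>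
        measure lebesgue ((E - F) \<union> (F - E)) \<le> \<epsilon> \<longrightarrow>
        charged_energy \<alpha> Q E \<le> charged_energy \<alpha> Q F)"

definition Hausdorff_local_minimizer :: "real \<Rightarrow> real \<Rightarrow> 'a::euclidean_space set \<Rightarrow> bool" where
  "Hausdorff_local_minimizer \<alpha> Q E \<longleftrightarrow> compact E \<and>
     (\<exists>\<epsilon>>0. \<forall>F. compact F \<and> measure lebesgue F = measure lebesgue E \<and>
        hausdorff_distance E F \<le> ennreal \<epsilon> \<longrightarrow>
        charged_energy \<alpha> Q E \<le> charged_energy \<alpha> Q F)"

end

theory Submission
  imports Defs "HOL-Probability.Probability_Measure"
begin

text \<open>
  Let \<open>\<mu>\<close> be an almost optimal charge on \<open>E\<close>. Averaging over \<open>N\<close> independent points of law \<open>\<mu>\<close> yields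
  points of \<open>E\<close> such that the charge spread uniformly over the \<open>N\<close> balls of radius \<open>r\<close> around them has
  almost the same energy, the self-energy of the balls being of order \<open>1 / (N r\<^sup>\<alpha>)\<close>. The perimeter of
  the balls is of order \<open>N r\<^bsup>d-1\<^esup>\<close>. Since \<open>\<alpha> < d - 1\<close>, both quantities tend to zero for
  \<open>N = r\<^bsup>-\<beta>\<^esup>\<close> with \<open>\<alpha> < \<beta> < d - 1\<close>. Dilating the cloud of balls by a factor slightly larger than \<open>1\<close>
  lowers its energy by a fixed factor. Adding it to \<open>E\<close> and shrinking the union back to volume \<open>|E|\<close>
  gives a competitor close to \<open>E\<close>, with nearly the same perimeter and strictly less Riesz energy.
  If \<open>E\<close> has infinite perimeter, a finite union of small balls covering \<open>E\<close>, shrunk to volume \<open>|E|\<close>,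
  already is a better competitor. Hausdorff-close sets of the same volume are \<open>L\<^sup>1\<close>-close, so both
  topologies are treated at once.
\<close>

section \<open>Compactly supported fields and cutoff functions\<close>

text \<open>\<open>E\<close> may be arbitrarily irregular, so it cannot be deformed with control of
  its perimeter. It is only enlarged by balls and dilated; for these operations one-sided perimeter
  bounds follow directly from the supremum over test fields. The gain is purely electrostatic: the
  whole charge leaves \<open>E\<close> and sits on the cloud, while \<open>E\<close> merely supplies
  volume. Shrinking the union back to volume |E| raises the energy, and the dilation of the cloud
  must outweigh this. The cloud is dilated by \<sigma>^2 and the union is shrunk by a factor not
  below 1/\<sigma>, which leaves a net dilation by at least \<sigma> and the energy factor
  \<sigma>^(-\<alpha>) < 1. As the energy of \<open>E\<close> is positive and finite, the gain has a
  fixed size, whereas the costs in perimeter, volume and discretisation can be made arbitrarily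
  small once \<sigma> is fixed. The tolerance in the minimality condition determines \<sigma>, and
  \<sigma> determines the gain. With infinite perimeter there are no finite numbers to compare,
  hence the separate competitor.\<close>

lemma C1c_fieldsE:
  fixes \<phi> :: "'a::euclidean_space \<Rightarrow> 'a"
  assumes "\<phi> \<in> C1c_fields"
  obtains \<phi>' :: "'a \<Rightarrow> 'a \<Rightarrow>\<^sub>L 'a" and R where
    "continuous_on UNIV \<phi>'" "\<forall>x. (\<phi> has_derivative blinfun_apply (\<phi>' x)) (at x)"
    "\<forall>x. divergence \<phi> x = (\<Sum>i\<in>Basis. \<phi>' x i \<bullet> i)"
    "\<forall>x. norm x > R \<longrightarrow> \<phi> x = 0" "\<forall>x. norm x > R \<longrightarrow> \<phi>' x = 0"
proof -
  have K: "compact (closure {x. \<phi> x \<noteq> 0})"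
    and "\<exists>\<phi>' :: 'a \<Rightarrow> 'a \<Rightarrow>\<^sub>L 'a. continuous_on UNIV \<phi>' \<and>
      (\<forall>x. (\<phi> has_derivative blinfun_apply (\<phi>' x)) (at x))"
    using assms by (simp_all only: C1c_fields_def mem_Collect_eq)
  then obtain \<phi>' :: "'a \<Rightarrow> 'a \<Rightarrow>\<^sub>L 'a" where c: "continuous_on UNIV \<phi>'"
    and d: "\<forall>x. (\<phi> has_derivative blinfun_apply (\<phi>' x)) (at x)"
    by (elim exE conjE)
  note d = d[rule_format]
  have div: "divergence \<phi> x = (\<Sum>i\<in>Basis. \<phi>' x i \<bullet> i)" for x
    by (simp only: divergence_def frechet_derivative_at[OF d[of x], symmetric])
  from compact_imp_bounded[OF K, unfolded bounded_iff]
  obtain R where R: "\<forall>x\<in>closure {x. \<phi> x \<noteq> 0}. norm x \<le> R" ..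
  have z: "\<phi> x = 0" if "norm x > R" for x
  proof (rule ccontr)
    assume "\<phi> x \<noteq> 0"
    then have "x \<in> closure {x. \<phi> x \<noteq> 0}" using closure_subset[of "{x. \<phi> x \<noteq> 0}"] by blast
    with R have "norm x \<le> R" by blast
    with that show False by simp
  qed
  have "\<phi>' x = 0" if x: "norm x > R" for x
  proof -
    have o: "open {x::'a. norm x > R}"
      by (intro open_Collect_less continuous_intros)
    have "(\<phi> has_derivative (\<lambda>h. 0)) (at x)"
      by (rule has_derivative_transform_within_open[OF has_derivative_const[of 0] o])
         (use x z in auto)
    then have "blinfun_apply (\<phi>' x) = (\<lambda>h. 0)"
      by (rule has_derivative_unique[OF d])
    then show ?thesis by (simp add: blinfun_eqI)
  qed
  then show ?thesis by (intro that[of \<phi>' R] allI impI c d div z)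
qed

lemma integrable_continuous_bounded_support:
  fixes f :: "'a::euclidean_space \<Rightarrow> real"
  assumes "continuous_on UNIV f" "\<And>x. norm x > R \<Longrightarrow> f x = 0"
  shows "integrable lborel f"
proof -
  have "integrable lborel (\<lambda>x. indicator (cball 0 R) x *\<^sub>R f x)"
    using assms(1) by (intro borel_integrable_compact) (auto intro: continuous_on_subset)
  moreover have "(\<lambda>x. indicator (cball 0 R) x *\<^sub>R f x) = f"
  proof
    show "indicator (cball 0 R) x *\<^sub>R f x = f x" for x
      using assms(2)[of x] by (cases "norm x \<le> R") simp_all
  qed
  ultimately show ?thesis by simp
qed

lemma bounded_continuous_bounded_support:
  fixes f :: "'a::euclidean_space \<Rightarrow> real"
  assumes "continuous_on UNIV f" "\<And>x. norm x > R \<Longrightarrow> f x = 0"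
  obtains M where "M \<ge> 0" "\<forall>x. \<bar>f x\<bar> \<le> M"
proof -
  have "compact (f ` cball 0 R)"
    using assms(1) by (intro compact_continuous_image) (auto intro: continuous_on_subset)
  then obtain M where M: "\<forall>y\<in>f ` cball 0 R. norm y \<le> M"
    using compact_imp_bounded bounded_iff by metis
  have "\<bar>f x\<bar> \<le> max M 0" for x
  proof (cases "norm x \<le> R")
    case True
    then have "norm (f x) \<le> M" using M by auto
    then show ?thesis by simp
  qed (use assms(2)[of x] in simp)
  then show ?thesis by (intro that[of "max M 0"]) simp_all
qed

lemma C1c_field_divergence:
  fixes \<phi> :: "'a::euclidean_space \<Rightarrow> 'a"
  assumes "\<phi> \<in> C1c_fields"
  shows "continuous_on UNIV \<phi>" "continuous_on UNIV (divergence \<phi>)"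
    "integrable lborel (divergence \<phi>)" "\<exists>M\<ge>0. \<forall>x. \<bar>divergence \<phi> x\<bar> \<le> M"
proof -
  obtain \<phi>' R where c: "continuous_on UNIV \<phi>'"
    and d: "\<forall>x. (\<phi> has_derivative blinfun_apply (\<phi>' x)) (at x)"
    and div: "\<forall>x. divergence \<phi> x = (\<Sum>i\<in>Basis. \<phi>' x i \<bullet> i)"
    and z: "\<forall>x. norm x > R \<longrightarrow> \<phi> x = 0" "\<forall>x. norm x > R \<longrightarrow> \<phi>' x = 0"
    by (rule C1c_fieldsE[OF assms])
  note d = d[rule_format] and div = div[rule_format] and z = z[rule_format]
  show "continuous_on UNIV \<phi>"
    by (intro continuous_at_imp_continuous_on ballI has_derivative_continuous[OF d])
  show cd: "continuous_on UNIV (divergence \<phi>)"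
  proof -
    have "continuous_on UNIV (\<lambda>x. \<Sum>i\<in>Basis. \<phi>' x i \<bullet> i)" by (intro continuous_intros c)
    moreover have "divergence \<phi> = (\<lambda>x. \<Sum>i\<in>Basis. \<phi>' x i \<bullet> i)" by (simp add: fun_eq_iff div)
    ultimately show ?thesis by simp
  qed
  have z': "norm x > R \<Longrightarrow> divergence \<phi> x = 0" for x
    by (simp add: div z)
  show "integrable lborel (divergence \<phi>)"
    by (rule integrable_continuous_bounded_support[OF cd z'])
  show "\<exists>M\<ge>0. \<forall>x. \<bar>divergence \<phi> x\<bar> \<le> M"
  proof -
    obtain M where "M \<ge> 0" "\<forall>x. \<bar>divergence \<phi> x\<bar> \<le> M"
      by (rule bounded_continuous_bounded_support[OF cd z'])
    then show ?thesis by blast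
  qed
qed

text \<open>By translation invariance every difference quotient has integral zero.\<close>

lemma integral_directional_derivative_eq_0:
  fixes f D :: "'a::euclidean_space \<Rightarrow> real"
  assumes deriv: "\<And>x. ((\<lambda>t. f (x + t *\<^sub>R i)) has_real_derivative D x) (at 0)"
    and f: "integrable lborel f" and D: "continuous_on UNIV D"
    and z: "\<And>x. norm x > R \<Longrightarrow> D x = 0"
  shows "integral\<^sup>L lborel D = 0"
proof -
  have der: "((\<lambda>t. f (x + t *\<^sub>R i)) has_real_derivative D (x + t *\<^sub>R i)) (at t)" for x t
    using DERIV_shift[of "\<lambda>t. f (x + t *\<^sub>R i)" "D (x + t *\<^sub>R i)" 0 t] deriv[of "x + t *\<^sub>R i"]
    by (simp add: algebra_simps)
  define T where "T n = 1 / real (Suc n)" for n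
  define s where "s n x = (f (x + T n *\<^sub>R i) - f x) / T n" for n x
  have T: "0 < T n" "T n \<le> 1" for n by (auto simp: T_def)
  \<comment> \<open>By the mean value theorem each difference quotient is a value of
    \<open>D\<close> at a nearby point. This yields both the pointwise limit, from continuity of
    \<open>D\<close>, and the uniform bound for dominated convergence.\<close>
  have "\<exists>u. 0 < u \<and> u < T n \<and> s n x = D (x + u *\<^sub>R i)" for n x
  proof -
    obtain u where "0 < u" "u < T n" "f (x + T n *\<^sub>R i) - f (x + 0 *\<^sub>R i) = (T n - 0) * D (x + u *\<^sub>R i)"
      using MVT2[OF T(1)[of n], of "\<lambda>t. f (x + t *\<^sub>R i)" "\<lambda>t. D (x + t *\<^sub>R i)"] der by blast
    then show ?thesis using T(1)[of n] unfolding s_def by (intro exI[of _ u]) (auto simp: field_simps)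
  qed
  then obtain u where u: "\<And>n x. 0 < u n x" "\<And>n x. u n x < T n" "\<And>n x. s n x = D (x + u n x *\<^sub>R i)"
    by metis
  have T0: "T \<longlonglongrightarrow> 0" unfolding T_def using LIMSEQ_inverse_real_of_nat by (simp add: inverse_eq_divide)
  obtain M where M: "M \<ge> 0" "\<forall>x. \<bar>D x\<bar> \<le> M"
    by (rule bounded_continuous_bounded_support[OF D z])
  have intf: "integrable lborel (\<lambda>x. f (x + c))" "(LBINT x. f (x + c)) = (LBINT x. f x)" for c
  proof -
    have fm: "f \<in> borel_measurable borel" using f by auto
    have "integrable (distr lborel borel ((+) c)) f" using f by (simp add: lborel_distr_plus)
    then show "integrable lborel (\<lambda>x. f (x + c))"
      by (subst (asm) integrable_distr_eq) (use fm in \<open>auto simp: add.commute\<close>)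
    have "integral\<^sup>L (distr lborel borel ((+) c)) f = (LBINT x. f (c + x))"
      by (rule integral_distr) (use fm in auto)
    then show "(LBINT x. f (x + c)) = (LBINT x. f x)"
      by (simp add: lborel_distr_plus add.commute)
  qed
  have s0: "integral\<^sup>L lborel (s n) = 0" for n
    unfolding s_def by (simp add: intf f)
  have "(\<lambda>n. integral\<^sup>L lborel (s n)) \<longlonglongrightarrow> integral\<^sup>L lborel D"
  \<comment> \<open>All increments \<open>T n\<close> are at most 1, so the evaluation point stays
    within \<open>norm i\<close> of \<open>x\<close>; enlarging the support radius by
    \<open>norm i\<close> covers every quotient at once.\<close>
  proof (rule integral_dominated_convergence[where w="\<lambda>x. M * indicator (cball 0 (R + norm i)) x"])
    show "D \<in> borel_measurable lborel" using D by (simp add: borel_measurable_continuous_onI)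
    show "s n \<in> borel_measurable lborel" for n
      unfolding s_def using intf(1)[THEN borel_measurable_integrable] f[THEN borel_measurable_integrable]
      by (intro borel_measurable_divide borel_measurable_diff) auto
    show "integrable lborel (\<lambda>x. M * indicator (cball (0::'a) (R + norm i)) x)"
      by (intro integrable_mult_right integrable_real_indicator)
         (use emeasure_lborel_cball_finite[of "0::'a" "R + norm i"] in auto)
    show "AE x in lborel. (\<lambda>n. s n x) \<longlonglongrightarrow> D x"
    proof (rule AE_I2)
      fix x
      have "(\<lambda>n. u n x) \<longlonglongrightarrow> 0"
      proof (rule tendsto_sandwich[OF _ _ tendsto_const T0])
        show "\<forall>\<^sub>F n in sequentially. 0 \<le> u n x" by (rule always_eventually) (simp add: u(1) less_imp_le)
        show "\<forall>\<^sub>F n in sequentially. u n x \<le> T n" by (rule always_eventually) (simp add: u(2) less_imp_le)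
      qed
      then have "(\<lambda>n. x + u n x *\<^sub>R i) \<longlonglongrightarrow> x + 0 *\<^sub>R i" by (intro tendsto_intros)
      then have "(\<lambda>n. D (x + u n x *\<^sub>R i)) \<longlonglongrightarrow> D x"
        using continuous_on_tendsto_compose[OF D, of "\<lambda>n. x + u n x *\<^sub>R i" x] by simp
      then show "(\<lambda>n. s n x) \<longlonglongrightarrow> D x" by (simp add: u)
    qed
    fix n
    have "norm (s n x) \<le> M * indicator (cball 0 (R + norm i)) x" for x
    proof (cases "norm x \<le> R + norm i")
      case True
      then show ?thesis using M(2) by (simp add: u)
    next
      case False
      have "norm (u n x *\<^sub>R i) \<le> norm i"
        using u(1,2)[of n x] T(2)[of n] by (simp add: mult_left_le_one_le)
      moreover have "norm x \<le> norm (x + u n x *\<^sub>R i) + norm (u n x *\<^sub>R i)"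
        using norm_triangle_ineq4[of "x + u n x *\<^sub>R i" "u n x *\<^sub>R i"] by simp
      ultimately show ?thesis using False z by (simp add: u)
    qed
    then show "AE x in lborel. norm (s n x) \<le> M * indicator (cball 0 (R + norm i)) x"
      by simp
  qed
  then show ?thesis using s0 by (simp add: LIMSEQ_const_iff)
qed

text \<open>Each summand of the divergence is the derivative, in direction \<open>i\<close>, of the
  compactly supported component of \<open>\<phi>\<close> along \<open>i\<close>, so the summands
  integrate to zero separately.\<close>

lemma integral_divergence_eq_0:
  fixes \<phi> :: "'a::euclidean_space \<Rightarrow> 'a"
  assumes "\<phi> \<in> C1c_fields"
  shows "integral\<^sup>L lborel (divergence \<phi>) = 0"
proof -
  obtain \<phi>' R where c: "continuous_on UNIV \<phi>'"
    and d: "\<forall>x. (\<phi> has_derivative blinfun_apply (\<phi>' x)) (at x)"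
    and div: "\<forall>x. divergence \<phi> x = (\<Sum>i\<in>Basis. \<phi>' x i \<bullet> i)"
    and z: "\<forall>x. norm x > R \<longrightarrow> \<phi> x = 0" "\<forall>x. norm x > R \<longrightarrow> \<phi>' x = 0"
    by (rule C1c_fieldsE[OF assms])
  note d = d[rule_format] and div = div[rule_format] and z = z[rule_format]
  have cc: "continuous_on UNIV (\<lambda>x. \<phi>' x i \<bullet> i)" for i by (intro continuous_intros c)
  have "(LBINT x. \<phi>' x i \<bullet> i) = 0" for i
  proof (rule integral_directional_derivative_eq_0[where f="\<lambda>x. \<phi> x \<bullet> i" and i=i and R=R])
    fix x
    have 1: "((\<lambda>t. x + t *\<^sub>R i) has_derivative (\<lambda>t. t *\<^sub>R i)) (at 0)"
      by (auto intro!: derivative_eq_intros)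
    have "((\<lambda>t. \<phi> (x + t *\<^sub>R i)) has_derivative (\<lambda>t. \<phi>' x (t *\<^sub>R i))) (at 0)"
      using has_derivative_compose[OF 1, of \<phi> "\<phi>' x"] d[of x] by simp
    then have "((\<lambda>t. \<phi> (x + t *\<^sub>R i) \<bullet> i) has_derivative (\<lambda>t. \<phi>' x (t *\<^sub>R i) \<bullet> i)) (at 0)"
      by (rule has_derivative_inner_left)
    then show "((\<lambda>t. \<phi> (x + t *\<^sub>R i) \<bullet> i) has_real_derivative \<phi>' x i \<bullet> i) (at 0)"
      by (simp add: has_field_derivative_def blinfun.scaleR_right mult_commute_abs)
  next
    show "integrable lborel (\<lambda>x. \<phi> x \<bullet> i)"
    proof (rule integrable_continuous_bounded_support)
      show "continuous_on UNIV (\<lambda>x. \<phi> x \<bullet> i)"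
        by (intro continuous_intros C1c_field_divergence(1)[OF assms])
      show "norm x > R \<Longrightarrow> \<phi> x \<bullet> i = 0" for x by (simp add: z)
    qed
    show "norm x > R \<Longrightarrow> \<phi>' x i \<bullet> i = 0" for x by (simp add: z)
  qed (rule cc)
  moreover have "integrable lborel (\<lambda>x. \<phi>' x i \<bullet> i)" for i
    by (rule integrable_continuous_bounded_support[OF cc, of R]) (simp add: z)
  moreover have "divergence \<phi> = (\<lambda>x. \<Sum>i\<in>Basis. \<phi>' x i \<bullet> i)" by (simp add: fun_eq_iff div)
  ultimately show ?thesis by simp
qed

text \<open>Localises test fields. The support of the product lies in that of \<open>\<phi>\<close>,
  so the multiplier may be a cutoff equal to 1 at infinity as well as its complement.\<close>

lemma C1c_fields_scale:
  fixes \<phi> :: "'a::euclidean_space \<Rightarrow> 'a" and \<eta> :: "'a \<Rightarrow> real"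
  assumes \<phi>: "\<phi> \<in> C1c_fields"
    and \<eta>: "\<And>x. (\<eta> has_derivative (\<lambda>h. g x \<bullet> h)) (at x)" and g: "continuous_on UNIV g"
  shows "(\<lambda>x. \<eta> x *\<^sub>R \<phi> x) \<in> C1c_fields"
    and "divergence (\<lambda>x. \<eta> x *\<^sub>R \<phi> x) x = \<eta> x * divergence \<phi> x + g x \<bullet> \<phi> x"
proof -
  obtain \<phi>' R where c: "continuous_on UNIV \<phi>'"
    and d: "\<forall>x. (\<phi> has_derivative blinfun_apply (\<phi>' x)) (at x)"
    and div: "\<forall>x. divergence \<phi> x = (\<Sum>i\<in>Basis. \<phi>' x i \<bullet> i)"
    and z: "\<forall>x. norm x > R \<longrightarrow> \<phi> x = 0" "\<forall>x. norm x > R \<longrightarrow> \<phi>' x = 0"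
    by (rule C1c_fieldsE[OF \<phi>])
  note d = d[rule_format] and div = div[rule_format] and z = z[rule_format]
  have c\<eta>: "continuous_on UNIV \<eta>"
    by (intro continuous_at_imp_continuous_on ballI has_derivative_continuous[OF \<eta>])
  have c\<phi>: "continuous_on UNIV \<phi>" using C1c_field_divergence(1)[OF \<phi>] .
  define \<psi>' where "\<psi>' x = \<eta> x *\<^sub>R \<phi>' x + (blinfun_scaleR_left (\<phi> x) o\<^sub>L blinfun_inner_left (g x))" for x
  have ap: "blinfun_apply (\<psi>' x) = (\<lambda>h. \<eta> x *\<^sub>R \<phi>' x h + (g x \<bullet> h) *\<^sub>R \<phi> x)" for x
    by (auto simp: \<psi>'_def blinfun.add_left blinfun.scaleR_left inner_commute)
  have d': "((\<lambda>x. \<eta> x *\<^sub>R \<phi> x) has_derivative blinfun_apply (\<psi>' x)) (at x)" for x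
    unfolding ap by (rule has_derivative_scaleR[OF \<eta> d])
  have c': "continuous_on UNIV \<psi>'"
    unfolding \<psi>'_def by (intro continuous_intros c c\<eta> c\<phi> g)
  have "closure {x. \<eta> x *\<^sub>R \<phi> x \<noteq> 0} \<subseteq> closure {x. \<phi> x \<noteq> 0}" by (intro closure_mono) auto
  moreover have "compact (closure {x. \<phi> x \<noteq> 0})" using \<phi> unfolding C1c_fields_def by blast
  ultimately have "compact (closure {x. \<eta> x *\<^sub>R \<phi> x \<noteq> 0})"
    by (meson closed_closure bounded_subset compact_eq_bounded_closed)
  then show "(\<lambda>x. \<eta> x *\<^sub>R \<phi> x) \<in> C1c_fields"
    unfolding C1c_fields_def using c' d' by blast
  have "divergence (\<lambda>x. \<eta> x *\<^sub>R \<phi> x) x = (\<Sum>i\<in>Basis. \<psi>' x i \<bullet> i)"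
    by (simp only: divergence_def frechet_derivative_at[OF d'[of x], symmetric])
  also have "\<dots> = \<eta> x * (\<Sum>i\<in>Basis. \<phi>' x i \<bullet> i) + (\<Sum>i\<in>Basis. (g x \<bullet> i) * (\<phi> x \<bullet> i))"
    by (simp add: ap inner_add_left sum.distrib sum_distrib_left)
  also have "(\<Sum>i\<in>Basis. (g x \<bullet> i) * (\<phi> x \<bullet> i)) = g x \<bullet> \<phi> x"
    by (rule euclidean_inner[symmetric])
  finally show "divergence (\<lambda>x. \<eta> x *\<^sub>R \<phi> x) x = \<eta> x * divergence \<phi> x + g x \<bullet> \<phi> x"
    by (simp add: div)
qed

text \<open>A quadratic spline, which has just the C1 regularity that \<open>C1c_fields\<close> asks
  for.\<close>

lemma C1_cutoff_on_real:
  obtains p p' :: "real \<Rightarrow> real" where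
    "\<forall>t. (p has_real_derivative p' t) (at t)" "continuous_on UNIV p'"
    "\<forall>t. 0 \<le> p t \<and> p t \<le> 1" "\<forall>t. 0 \<le> p' t \<and> p' t \<le> 2"
    "\<forall>t\<le>0. p t = 0 \<and> p' t = 0" "\<forall>t\<ge>1. p t = 1 \<and> p' t = 0"
proof -
  define q :: "real \<Rightarrow> real" where "q t = (max 0 t)\<^sup>2" for t
  have q: "(q has_real_derivative 2 * max 0 t) (at t)" for t
  proof -
    \<comment> \<open>A quadratic remainder bound, checked by the signs of \<open>s\<close> and
      \<open>t\<close>, gives the derivative at every point at once, including the kink at
      0.\<close>
    have bound: "\<bar>q s - q t - 2 * max 0 t * (s - t)\<bar> \<le> (s - t)\<^sup>2" for s
    proof -
      consider "t \<ge> 0" "s \<ge> 0" | "t \<le> 0" "s \<le> 0" | "t \<le> 0" "s \<ge> 0" | "t \<ge> 0" "s \<le> 0" by linarith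
      then show ?thesis
      proof cases
        case 1
        then have "q s - q t - 2 * max 0 t * (s - t) = (s - t)\<^sup>2"
          by (simp add: q_def max_def power2_eq_square algebra_simps)
        then show ?thesis by simp
      next
        case 2
        then show ?thesis by (simp add: q_def max_def)
      next
        case 3
        then have "q s - q t - 2 * max 0 t * (s - t) = s\<^sup>2" by (auto simp: q_def max_def)
        then show ?thesis using 3 by (simp add: power_mono)
      next
        case 4
        then have "q s - q t - 2 * max 0 t * (s - t) = t\<^sup>2 - 2 * (t * s)"
          by (auto simp: q_def max_def power2_eq_square algebra_simps)
        moreover have "t * s \<le> 0" using 4 by (simp add: mult_nonneg_nonpos)
        moreover have "(s - t)\<^sup>2 = t\<^sup>2 - 2 * (t * s) + s\<^sup>2"
          by (simp add: power2_eq_square algebra_simps)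
        moreover have "t\<^sup>2 \<ge> 0" "s\<^sup>2 \<ge> 0" by auto
        ultimately show ?thesis by linarith
      qed
    qed
    have "((\<lambda>s. (q s - q t) / (s - t) - 2 * max 0 t) \<longlongrightarrow> 0) (at t)"
    proof (rule Lim_null_comparison)
      show "\<forall>\<^sub>F s in at t. norm ((q s - q t) / (s - t) - 2 * max 0 t) \<le> \<bar>s - t\<bar>"
      proof (rule eventually_mono[OF eventually_neq_at_within[of t]])
        fix s assume st: "s \<noteq> t"
        then have "(q s - q t) / (s - t) - 2 * max 0 t = (q s - q t - 2 * max 0 t * (s - t)) / (s - t)"
          by (simp add: diff_divide_distrib)
        also have "\<bar>\<dots>\<bar> \<le> (s - t)\<^sup>2 / \<bar>s - t\<bar>"
          using bound[of s] by (simp add: abs_divide divide_right_mono)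
        also have "\<dots> = \<bar>s - t\<bar>" using st by (simp add: power2_eq_square divide_eq_eq flip: abs_mult)
        finally show "norm ((q s - q t) / (s - t) - 2 * max 0 t) \<le> \<bar>s - t\<bar>" by simp
      qed
      show "((\<lambda>s. \<bar>s - t\<bar>) \<longlongrightarrow> 0) (at t)" by (auto intro!: tendsto_eq_intros)
    qed
    then have "((\<lambda>s. (q s - q t) / (s - t)) \<longlongrightarrow> 2 * max 0 t) (at t)" by (rule LIM_zero_cancel)
    then show ?thesis by (simp add: has_field_derivative_iff)
  qed
  \<comment> \<open>\<open>p'\<close> is the tent on [0,1] with slopes 4 and -4 and peak 2 at 1/2;
    its area is 1, which makes \<open>p\<close> climb from 0 to 1.\<close>
  define p where "p t = 2 * q t - 4 * q (t - 1/2) + 2 * q (t - 1)" for t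
  define p' where "p' t = 4 * max 0 t - 8 * max 0 (t - 1/2) + 4 * max 0 (t - 1)" for t :: real
    have d: "(p has_real_derivative p' t) (at t)" for t
    proof -
      have "((\<lambda>t. q (t - a)) has_real_derivative 2 * max 0 (t - a)) (at t)" for a
        using DERIV_shift[of q "2 * max 0 (t - a)" t "- a"] q[of "t - a"] by simp
      then show ?thesis unfolding p_def p'_def by (auto intro!: derivative_eq_intros q)
    qed
    have c: "continuous_on UNIV p'" unfolding p'_def by (intro continuous_intros)
    have p': "0 \<le> p' t \<and> p' t \<le> 2" for t by (auto simp: p'_def max_def)
    have a: "t \<le> 0 \<Longrightarrow> p t = 0 \<and> p' t = 0" for t by (auto simp: p_def q_def p'_def max_def)
    have b: "t \<ge> 1 \<Longrightarrow> p t = 1 \<and> p' t = 0" for t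
      by (auto simp: p_def q_def p'_def max_def power2_eq_square algebra_simps)
    have e: "0 \<le> p t \<and> p t \<le> 1" for t
    proof -
      consider "t \<le> 0" | "t \<ge> 1" | "0 < t" "t \<le> 1/2" | "1/2 < t" "t < 1" by linarith
      then show ?thesis
      proof cases
        case 3
        then have "p t = 2 * t\<^sup>2" "t\<^sup>2 \<le> (1/2)\<^sup>2" by (auto simp: p_def q_def intro!: power_mono)
        then show ?thesis by (auto simp: power2_eq_square)
      next
        case 4
        then have "p t = 1 - 2 * (1 - t)\<^sup>2" "(1 - t)\<^sup>2 \<le> (1/2)\<^sup>2"
          by (simp add: p_def q_def power2_eq_square algebra_simps, intro power_mono) auto
        then show ?thesis by (auto simp: power2_eq_square)
      qed (use a b in auto)
    qed
  show ?thesis by (intro that[of p p'] allI impI c d p' a b e)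
qed

text \<open>The profile is composed with the squared distance, a polynomial that is smooth even at
  the centre. The normalisation \<open>w\<close> makes \<open>s\<close> run from 0 at radius
  \<open>r\<close> to 1 at radius \<open>r + \<delta>\<close>.\<close>

lemma C1_cutoff_cball:
  fixes c :: "'a::euclidean_space"
  assumes "r > 0" "\<delta> > 0"
  obtains \<eta> :: "'a \<Rightarrow> real" and g where
    "\<forall>x. (\<eta> has_derivative (\<lambda>h. g x \<bullet> h)) (at x)" "continuous_on UNIV g"
    "\<forall>x. 0 \<le> \<eta> x \<and> \<eta> x \<le> 1" "\<forall>x. norm (g x) \<le> 4 / \<delta>"
    "\<forall>x. dist c x \<le> r \<longrightarrow> \<eta> x = 0 \<and> g x = 0" "\<forall>x. dist c x \<ge> r + \<delta> \<longrightarrow> \<eta> x = 1 \<and> g x = 0"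
proof -
  obtain p p' :: "real \<Rightarrow> real" where p: "\<forall>t. (p has_real_derivative p' t) (at t)" "continuous_on UNIV p'"
    "\<forall>t. 0 \<le> p t \<and> p t \<le> 1" "\<forall>t. 0 \<le> p' t \<and> p' t \<le> 2"
    "\<forall>t\<le>0. p t = 0 \<and> p' t = 0" "\<forall>t\<ge>1. p t = 1 \<and> p' t = 0"
    by (rule C1_cutoff_on_real)
  note p = p[rule_format]
  define w where "w = (r + \<delta>)\<^sup>2 - r\<^sup>2"
  have w: "w = \<delta> * (2 * r + \<delta>)" "w > 0" using assms by (auto simp: w_def power2_eq_square algebra_simps intro!: add_pos_pos)
  define s where "s x = ((x - c) \<bullet> (x - c) - r\<^sup>2) / w" for x
  define g where "g x = (p' (s x) * 2 / w) *\<^sub>R (x - c)" for x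
  have s: "(x - c) \<bullet> (x - c) = (dist c x)\<^sup>2" for x by (subst dist_commute) (simp add: dist_norm power2_norm_eq_inner)
  have s0: "s x \<le> 0" if "dist c x \<le> r" for x
    using that w by (simp add: s_def s divide_le_0_iff power_mono)
  have s1: "s x \<ge> 1" if "dist c x \<ge> r + \<delta>" for x
  proof -
    have "(r + \<delta>)\<^sup>2 \<le> (dist c x)\<^sup>2" using that assms by (intro power_mono) auto
    then show ?thesis using w(2) by (simp add: s_def s le_divide_eq) (simp add: w_def)
  qed
  show ?thesis
  proof (intro that[of "\<lambda>x. p (s x)" g] allI impI)
    fix x
    have "(s has_derivative (\<lambda>h. (2 / w) *\<^sub>R ((x - c) \<bullet> h))) (at x)"
      unfolding s_def using w(2)
      by (auto intro!: derivative_eq_intros simp: fun_eq_iff inner_commute field_simps)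
    from has_derivative_compose[OF this p(1)[unfolded has_field_derivative_def]]
    show "((\<lambda>x. p (s x)) has_derivative (\<lambda>h. g x \<bullet> h)) (at x)"
      by (rule has_derivative_eq_rhs) (auto simp: g_def fun_eq_iff)
    have "dist c x \<le> r + \<delta> \<Longrightarrow> norm (g x) \<le> 4 / \<delta>"
    proof -
      assume d: "dist c x \<le> r + \<delta>"
      have "norm (g x) = p' (s x) * 2 / w * dist c x"
        using p(4)[of "s x"] w(2) by (simp add: g_def dist_norm norm_minus_commute)
      \<comment> \<open>The radius is relaxed from \<open>r + \<delta>\<close> to
        \<open>2 * r + \<delta>\<close> because the latter is a factor of \<open>w\<close> and
        cancels.\<close>
      also have "\<dots> \<le> 2 * 2 / w * (2 * r + \<delta>)"
        using p(4)[of "s x"] w(2) d assms by (intro mult_mono divide_right_mono) auto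
      also have "\<dots> = 4 / \<delta>" using assms w by (simp add: field_simps)
      finally show ?thesis .
    qed
    moreover have "dist c x \<ge> r + \<delta> \<Longrightarrow> g x = 0" using p(6)[OF s1] by (simp add: g_def)
    ultimately show "norm (g x) \<le> 4 / \<delta>" using assms by (cases "dist c x \<le> r + \<delta>") auto
    show "0 \<le> p (s x) \<and> p (s x) \<le> 1" using p(3) by simp
    show "dist c x \<le> r \<Longrightarrow> p (s x) = 0 \<and> g x = 0" using p(5)[OF s0] by (simp add: g_def)
    show "dist c x \<ge> r + \<delta> \<Longrightarrow> p (s x) = 1 \<and> g x = 0" using p(6)[OF s1] by (simp add: g_def)
  next
    have cs: "continuous_on UNIV s" unfolding s_def using w by (intro continuous_intros) auto
    show "continuous_on UNIV g"
      unfolding g_def using w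
      by (intro continuous_intros continuous_on_compose2[OF p(2) cs]) auto
  qed
qed

section \<open>Perimeter of unions with balls and of dilations\<close>

lemma set_integral_divergence_lebesgue:
  fixes \<phi> :: "'a::euclidean_space \<Rightarrow> 'a"
  assumes "\<phi> \<in> C1c_fields" "E \<in> sets borel"
  shows "(LINT x:E|lebesgue. divergence \<phi> x) = (LBINT x:E. divergence \<phi> x)"
  unfolding set_lebesgue_integral_def
  using borel_measurable_integrable[OF C1c_field_divergence(3)[OF assms(1)]] assms(2)
  by (intro integral_completion) auto

lemma divergence_le_perimeter:
  fixes \<phi> :: "'a::euclidean_space \<Rightarrow> 'a"
  assumes "\<phi> \<in> C1c_fields" "\<And>x. norm (\<phi> x) \<le> 1" "E \<in> sets borel"
  shows "ennreal (LBINT x:E. divergence \<phi> x) \<le> perimeter E"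
  unfolding perimeter_def set_integral_divergence_lebesgue[OF assms(1,3), symmetric]
  using assms(1,2) by (intro SUP_upper) auto

lemma perimeter_leI:
  fixes E :: "'a::euclidean_space set"
  assumes "E \<in> sets borel"
    and "\<And>\<phi>. \<phi> \<in> C1c_fields \<Longrightarrow> (\<And>x. norm (\<phi> x) \<le> 1) \<Longrightarrow> ennreal (LBINT x:E. divergence \<phi> x) \<le> c"
  shows "perimeter E \<le> c"
  unfolding perimeter_def
  by (intro SUP_least) (auto simp: set_integral_divergence_lebesgue[OF _ assms(1)] assms(2))

lemma perimeter_empty: "perimeter ({} :: 'a::euclidean_space set) = 0"
proof -
  have "perimeter ({} :: 'a set) \<le> 0" by (rule perimeter_leI) (auto simp: set_lebesgue_integral_def)
  then show ?thesis by simp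
qed

lemma power_diff_le:
  fixes a b :: real
  assumes "0 \<le> b" "b \<le> a"
  shows "a ^ n - b ^ n \<le> real n * (a - b) * a ^ (n - 1)"
proof (induction n)
  case (Suc n)
  have "a ^ Suc n - b ^ Suc n = a * (a ^ n - b ^ n) + (a - b) * b ^ n" by (simp add: algebra_simps)
  also have "\<dots> \<le> a * (real n * (a - b) * a ^ (n - 1)) + (a - b) * a ^ n"
    using assms Suc by (intro add_mono mult_left_mono power_mono) auto
  also have "\<dots> = real (Suc n) * (a - b) * a ^ n"
    by (cases n) (auto simp: algebra_simps)
  finally show ?case by simp
qed simp

lemma content_annulus_le:
  fixes c :: "'a::euclidean_space"
  assumes "0 < r" "0 < \<delta>" "\<delta> \<le> r"
  shows "measure lborel (cball c (r + \<delta>) - cball c r)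
    \<le> unit_ball_vol DIM('a) * DIM('a) * (2 * r) ^ (DIM('a) - 1) * \<delta>"
proof -
  let ?w = "unit_ball_vol DIM('a)"
  have w: "?w \<ge> 0" by simp
  have fin: "emeasure lborel (cball c (r + \<delta>)) \<noteq> \<infinity>"
    using emeasure_lborel_cball_finite[of c "r + \<delta>"] by simp
  have "measure lborel (cball c (r + \<delta>) - cball c r)
    = measure lborel (cball c (r + \<delta>)) - measure lborel (cball c r)"
    using assms by (intro measure_Diff fin) (auto simp: subset_cball)
  also have "\<dots> = ?w * ((r + \<delta>) ^ DIM('a) - r ^ DIM('a))"
    using assms by (simp add: content_cball right_diff_distrib)
  also have "(r + \<delta>) ^ DIM('a) - r ^ DIM('a) \<le> real DIM('a) * \<delta> * (r + \<delta>) ^ (DIM('a) - 1)"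
    using power_diff_le[of r "r + \<delta>" "DIM('a)"] assms by simp
  also have "\<dots> \<le> real DIM('a) * \<delta> * (2 * r) ^ (DIM('a) - 1)"
    using assms by (intro mult_left_mono power_mono) auto
  finally show ?thesis using w by (simp add: mult_left_mono algebra_simps)
qed

text \<open>A test field splits into a part vanishing on the ball, which only sees \<open>E\<close>, and a part
  supported in a slightly larger ball, whose divergence has total integral zero.\<close>

lemma perimeter_Un_cball_le:
  fixes E :: "'a::euclidean_space set"
  assumes E: "E \<in> sets borel" and r: "r > 0"
  shows "perimeter (E \<union> cball c r) \<le>
    perimeter E + ennreal (5 * unit_ball_vol DIM('a) * DIM('a) * (2 * r) ^ (DIM('a) - 1))"
proof (rule perimeter_leI)
  show "E \<union> cball c r \<in> sets borel" using E by auto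
next
  fix \<phi> :: "'a \<Rightarrow> 'a" assume \<phi>: "\<phi> \<in> C1c_fields" and le1: "\<And>x. norm (\<phi> x) \<le> 1"
  let ?D = "divergence \<phi>"
  let ?B = "cball c r"
  obtain M where M: "M \<ge> 0" "\<forall>x. \<bar>?D x\<bar> \<le> M" using C1c_field_divergence(4)[OF \<phi>] by auto
  \<comment> \<open>The width of the annulus depends on the test field. Since
    \<open>M * \<delta> \<le> 1\<close>, multiplying \<open>M + 4 / \<delta>\<close> by an annulus
    volume of order r^(d-1) \<delta> leaves at most 1 + 4 times r^(d-1), uniformly in the field.
    This is the 5 in the statement.\<close>
  define \<delta> where "\<delta> = min r (1 / (M + 1))"
  have \<delta>: "\<delta> > 0" "\<delta> \<le> r" using r M by (auto simp: \<delta>_def)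
  have "M * \<delta> \<le> M * (1 / (M + 1))" using M(1) by (intro mult_left_mono) (auto simp: \<delta>_def)
  also have "\<dots> \<le> 1" using M(1) by simp
  finally have M\<delta>: "M * \<delta> \<le> 1" .
  obtain \<eta> :: "'a \<Rightarrow> real" and g where \<eta>: "\<forall>x. (\<eta> has_derivative (\<lambda>h. g x \<bullet> h)) (at x)"
    and g: "continuous_on UNIV g"
    and \<eta>01: "\<forall>x. 0 \<le> \<eta> x \<and> \<eta> x \<le> 1" and gle: "\<forall>x. norm (g x) \<le> 4 / \<delta>"
    and inner: "\<forall>x. dist c x \<le> r \<longrightarrow> \<eta> x = 0 \<and> g x = 0"
    and outer: "\<forall>x. dist c x \<ge> r + \<delta> \<longrightarrow> \<eta> x = 1 \<and> g x = 0"
    by (rule C1_cutoff_cball[OF r \<delta>(1)])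
  note \<eta> = \<eta>[rule_format]
  have \<eta>': "((\<lambda>x. 1 - \<eta> x) has_derivative (\<lambda>h. (- g x) \<bullet> h)) (at x)" for x
    by (rule has_derivative_eq_rhs[OF has_derivative_diff[OF has_derivative_const \<eta>]]) (simp add: fun_eq_iff)
  have g': "continuous_on UNIV (\<lambda>x. - g x)" by (intro continuous_intros g)
  define \<psi> where "\<psi> x = \<eta> x *\<^sub>R \<phi> x" for x
  define \<xi> where "\<xi> x = (1 - \<eta> x) *\<^sub>R \<phi> x" for x
  have \<psi>C: "\<psi> \<in> C1c_fields" and D\<psi>: "divergence \<psi> x = \<eta> x * ?D x + g x \<bullet> \<phi> x" for x
    unfolding \<psi>_def by (rule C1c_fields_scale[OF \<phi> \<eta> g])+
  have \<xi>C: "\<xi> \<in> C1c_fields" and D\<xi>: "divergence \<xi> x = (1 - \<eta> x) * ?D x + (- g x) \<bullet> \<phi> x" for x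
    unfolding \<xi>_def by (rule C1c_fields_scale[OF \<phi> \<eta>' g'])+
  note int = C1c_field_divergence(3)[OF \<psi>C] C1c_field_divergence(3)[OF \<xi>C]
  have EB: "E \<union> ?B \<in> sets lborel" using E by auto
  note intI = integrable_mult_indicator[OF EB int(1)] integrable_mult_indicator[OF EB int(2)]
  have \<psi>1: "norm (\<psi> x) \<le> 1" for x
    using \<eta>01[rule_format, of x] le1[of x] by (simp add: \<psi>_def mult_le_one)
  let ?A = "cball c (r + \<delta>) - ?B"
  have A: "?A \<in> sets lborel" by auto
  have fA: "emeasure lborel ?A < \<infinity>"
    by (rule le_less_trans[OF emeasure_mono emeasure_lborel_cball_finite[of c "r + \<delta>"]]) auto
  have "(LBINT x:E \<union> ?B. ?D x) =
      (LBINT x. indicator (E \<union> ?B) x *\<^sub>R divergence \<psi> x + indicator (E \<union> ?B) x *\<^sub>R divergence \<xi> x)"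
    unfolding set_lebesgue_integral_def
    by (rule Bochner_Integration.integral_cong) (auto simp: D\<psi> D\<xi> algebra_simps)
  also have "\<dots> = (LBINT x. indicator (E \<union> ?B) x *\<^sub>R divergence \<psi> x)
      + (LBINT x. indicator (E \<union> ?B) x *\<^sub>R divergence \<xi> x)"
    by (rule Bochner_Integration.integral_add[OF intI])
  \<comment> \<open>Both \<open>\<eta>\<close> and its gradient vanish on the ball, so the ball
    drops out of the domain of integration.\<close>
  also have "(LBINT x. indicator (E \<union> ?B) x *\<^sub>R divergence \<psi> x) = (LBINT x:E. divergence \<psi> x)"
    unfolding set_lebesgue_integral_def
    by (rule Bochner_Integration.integral_cong) (auto simp: D\<psi> inner indicator_def)
  \<comment> \<open>Subtracting the vanishing total integral leaves minus the integral over the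
    complement of the union, where the divergence of \<open>\<xi>\<close> lives only in the
    annulus.\<close>
  also have "(LBINT x. indicator (E \<union> ?B) x *\<^sub>R divergence \<xi> x) =
      (LBINT x. indicator (E \<union> ?B) x *\<^sub>R divergence \<xi> x - divergence \<xi> x)"
    using integral_divergence_eq_0[OF \<xi>C] intI(2) int(2)
    by (subst Bochner_Integration.integral_diff) auto
  also have "\<dots> \<le> (LBINT x. (M + 4 / \<delta>) * indicator ?A x)"
  proof (rule integral_mono)
    show "integrable lborel (\<lambda>x. indicator (E \<union> ?B) x *\<^sub>R divergence \<xi> x - divergence \<xi> x)"
      by (intro Bochner_Integration.integrable_diff intI(2) int(2))
    show "integrable lborel (\<lambda>x. (M + 4 / \<delta>) * indicator ?A x)"
      by (intro integrable_mult_right integrable_real_indicator A fA)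
    fix x
    have bd: "\<bar>divergence \<xi> x\<bar> \<le> M + 4 / \<delta>"
    proof -
      have "\<bar>(1 - \<eta> x) * ?D x\<bar> \<le> 1 * M"
        unfolding abs_mult using \<eta>01[rule_format, of x] M by (intro mult_mono) auto
      moreover have "\<bar>g x \<bullet> \<phi> x\<bar> \<le> 4 / \<delta> * 1"
        using gle le1[of x] \<delta>(1) by (intro order_trans[OF Cauchy_Schwarz_ineq2] mult_mono) auto
      ultimately show ?thesis unfolding D\<xi> by simp
    qed
    show "indicator (E \<union> ?B) x *\<^sub>R divergence \<xi> x - divergence \<xi> x \<le> (M + 4 / \<delta>) * indicator ?A x"
    proof (cases "x \<in> E \<union> ?B")
      case True
      then show ?thesis using M(1) \<delta>(1) by simp
    next
      case False
      show ?thesis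
      proof (cases "dist c x \<ge> r + \<delta>")
        case True
        then have "divergence \<xi> x = 0" using outer D\<xi> by simp
        then show ?thesis using M(1) \<delta>(1) by simp
      next
        case far: False
        then have "x \<in> ?A" using False by auto
        then show ?thesis using bd False by simp
      qed
    qed
  qed
  also have "(LBINT x. (M + 4 / \<delta>) * indicator ?A x) = (M + 4 / \<delta>) * measure lborel ?A"
    using A fA by simp
  also have "\<dots> \<le> (M + 4 / \<delta>) * (unit_ball_vol DIM('a) * DIM('a) * (2 * r) ^ (DIM('a) - 1) * \<delta>)"
    using M(1) \<delta> r by (intro mult_left_mono content_annulus_le) auto
  also have "\<dots> = (M * \<delta> + 4) * (unit_ball_vol DIM('a) * DIM('a) * (2 * r) ^ (DIM('a) - 1))"
    using \<delta>(1) by (simp add: field_simps)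
  also have "\<dots> \<le> 5 * (unit_ball_vol DIM('a) * DIM('a) * (2 * r) ^ (DIM('a) - 1))"
    using M\<delta> r by (intro mult_right_mono) auto
  finally have le: "(LBINT x:E \<union> ?B. ?D x) \<le> (LBINT x:E. divergence \<psi> x)
      + 5 * unit_ball_vol DIM('a) * DIM('a) * (2 * r) ^ (DIM('a) - 1)" (is "_ \<le> ?I + ?K")
    by (simp add: mult.assoc)
  have K: "?K \<ge> 0" using r by simp
  \<comment> \<open>The integral over \<open>E\<close> may be negative, in which case
    \<open>ennreal\<close> truncates it; \<open>max 0\<close> makes the sum compatible with this
    truncation.\<close>
  have "ennreal (LBINT x:E \<union> ?B. ?D x) \<le> ennreal (max 0 ?I + ?K)"
    using le by (intro ennreal_leI) auto
  also have "\<dots> = ennreal ?I + ennreal ?K" using K by (simp add: ennreal_plus max_def ennreal_neg)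
  also have "\<dots> \<le> perimeter E + ennreal ?K"
    by (intro add_mono divergence_le_perimeter[OF \<psi>C \<psi>1 E]) auto
  finally show "ennreal (LBINT x:E \<union> ?B. ?D x) \<le> perimeter E + ennreal ?K" .
qed

lemma perimeter_Un_cballs_le:
  fixes E :: "'a::euclidean_space set"
  assumes E: "E \<in> sets borel" and r: "r > 0"
  shows "perimeter (E \<union> (\<Union>i<N. cball (c i) r)) \<le>
    perimeter E + ennreal (real N * (5 * unit_ball_vol DIM('a) * DIM('a) * (2 * r) ^ (DIM('a) - 1)))"
    (is "_ \<le> _ + ennreal (_ * ?K)")
proof (induction N)
  case (Suc N)
  have K: "?K \<ge> 0" using r by simp
  let ?U = "\<Union>i<N. cball (c i) r"
  have "perimeter (E \<union> (\<Union>i<Suc N. cball (c i) r)) = perimeter ((E \<union> ?U) \<union> cball (c N) r)"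
    by (simp add: lessThan_Suc Un_ac)
  also have "\<dots> \<le> perimeter (E \<union> ?U) + ennreal ?K"
    using E by (intro perimeter_Un_cball_le r) auto
  also have "\<dots> \<le> perimeter E + ennreal (real N * ?K) + ennreal ?K"
    using Suc by (intro add_mono) auto
  also have "\<dots> = perimeter E + ennreal (real (Suc N) * ?K)"
    using K by (simp add: add.assoc ennreal_plus[symmetric] algebra_simps del: ennreal_plus)
  finally show ?case .
qed simp

section \<open>Dilations: Lebesgue integral, perimeter and volume\<close>

lemma lborel_eq_density_scaleR:
  assumes "c \<noteq> 0"
  shows "(lborel :: 'a::euclidean_space measure) =
    density (distr lborel borel (\<lambda>x. c *\<^sub>R x)) (\<lambda>_. ennreal (\<bar>c\<bar> ^ DIM('a)))"
  using lborel_affine[OF assms, of 0] by simp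

lemma lborel_integral_scaleR:
  fixes f :: "'a::euclidean_space \<Rightarrow> real"
  assumes c: "c \<noteq> 0" and f: "f \<in> borel_measurable borel"
  shows "integral\<^sup>L lborel f = \<bar>c\<bar> ^ DIM('a) * (LBINT x. f (c *\<^sub>R x))"
proof -
  have "integral\<^sup>L lborel f =
      integral\<^sup>L (density (distr lborel borel (\<lambda>x. c *\<^sub>R x)) (\<lambda>_. ennreal (\<bar>c\<bar> ^ DIM('a)))) f"
    using lborel_eq_density_scaleR[OF c, where 'a='a] by simp
  also have "\<dots> = (LINT x|distr lborel borel (\<lambda>x. c *\<^sub>R x). \<bar>c\<bar> ^ DIM('a) *\<^sub>R f x)"
    using f by (intro integral_density) auto
  also have "\<dots> = (LBINT x. \<bar>c\<bar> ^ DIM('a) *\<^sub>R f (c *\<^sub>R x))"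
    using f by (intro integral_distr) auto
  finally show ?thesis by simp
qed

lemma lborel_nn_integral_scaleR:
  fixes f :: "'a::euclidean_space \<Rightarrow> ennreal"
  assumes c: "c \<noteq> 0" and f: "f \<in> borel_measurable borel"
  shows "integral\<^sup>N lborel f = ennreal (\<bar>c\<bar> ^ DIM('a)) * (\<integral>\<^sup>+x. f (c *\<^sub>R x) \<partial>lborel)"
proof -
  have "integral\<^sup>N lborel f =
      integral\<^sup>N (density (distr lborel borel (\<lambda>x. c *\<^sub>R x)) (\<lambda>_. ennreal (\<bar>c\<bar> ^ DIM('a)))) f"
    using lborel_eq_density_scaleR[OF c, where 'a='a] by simp
  also have "\<dots> = (\<integral>\<^sup>+x. ennreal (\<bar>c\<bar> ^ DIM('a)) * f x \<partial>distr lborel borel (\<lambda>x. c *\<^sub>R x))"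
    using f by (intro nn_integral_density) auto
  also have "\<dots> = (\<integral>\<^sup>+x. ennreal (\<bar>c\<bar> ^ DIM('a)) * f (c *\<^sub>R x) \<partial>lborel)"
    using f by (intro nn_integral_distr) auto
  also have "\<dots> = ennreal (\<bar>c\<bar> ^ DIM('a)) * (\<integral>\<^sup>+x. f (c *\<^sub>R x) \<partial>lborel)"
    using f by (intro nn_integral_cmult) auto
  finally show ?thesis .
qed

lemma C1c_fields_dilation:
  fixes \<phi> :: "'a::euclidean_space \<Rightarrow> 'a"
  assumes \<phi>: "\<phi> \<in> C1c_fields" and l: "l > 0"
  shows "(\<lambda>x. \<phi> (l *\<^sub>R x)) \<in> C1c_fields"
    and "divergence (\<lambda>x. \<phi> (l *\<^sub>R x)) x = l * divergence \<phi> (l *\<^sub>R x)"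
proof -
  obtain \<phi>' R where c: "continuous_on UNIV \<phi>'"
    and d: "\<forall>x. (\<phi> has_derivative blinfun_apply (\<phi>' x)) (at x)"
    and div: "\<forall>x. divergence \<phi> x = (\<Sum>i\<in>Basis. \<phi>' x i \<bullet> i)"
    and z: "\<forall>x. norm x > R \<longrightarrow> \<phi> x = 0" "\<forall>x. norm x > R \<longrightarrow> \<phi>' x = 0"
    by (rule C1c_fieldsE[OF \<phi>])
  note d = d[rule_format] and div = div[rule_format] and z = z[rule_format]
  define \<psi>' where "\<psi>' x = l *\<^sub>R \<phi>' (l *\<^sub>R x)" for x
  have d': "((\<lambda>x. \<phi> (l *\<^sub>R x)) has_derivative blinfun_apply (\<psi>' x)) (at x)" for x
  proof -
    have 1: "((\<lambda>x. l *\<^sub>R x) has_derivative (\<lambda>h. l *\<^sub>R h)) (at x)"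
      by (intro derivative_intros)
    show ?thesis
      by (rule has_derivative_eq_rhs[OF has_derivative_compose[OF 1 d]])
         (simp add: \<psi>'_def fun_eq_iff blinfun.scaleR_left blinfun.scaleR_right)
  qed
  have c': "continuous_on UNIV \<psi>'"
    unfolding \<psi>'_def by (intro continuous_intros continuous_on_compose2[OF c]) auto
  have "{x. \<phi> (l *\<^sub>R x) \<noteq> 0} \<subseteq> cball 0 (R / l)"
  proof
    fix x assume "x \<in> {x. \<phi> (l *\<^sub>R x) \<noteq> 0}"
    then have "norm (l *\<^sub>R x) \<le> R" using z(1)[of "l *\<^sub>R x"] by force
    then show "x \<in> cball 0 (R / l)" using l by (simp add: pos_le_divide_eq mult.commute)
  qed
  then have "bounded {x. \<phi> (l *\<^sub>R x) \<noteq> 0}" by (rule bounded_subset[OF bounded_cball])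
  then have "compact (closure {x. \<phi> (l *\<^sub>R x) \<noteq> 0})" by simp
  then show "(\<lambda>x. \<phi> (l *\<^sub>R x)) \<in> C1c_fields"
    unfolding C1c_fields_def using c' d' by blast
  have "divergence (\<lambda>x. \<phi> (l *\<^sub>R x)) x = (\<Sum>i\<in>Basis. \<psi>' x i \<bullet> i)"
    by (simp only: divergence_def frechet_derivative_at[OF d'[of x], symmetric])
  then show "divergence (\<lambda>x. \<phi> (l *\<^sub>R x)) x = l * divergence \<phi> (l *\<^sub>R x)"
    by (simp add: div \<psi>'_def blinfun.scaleR_left sum_distrib_left)
qed

lemma indicator_scaleR_image:
  fixes l :: real and E :: "'a::real_vector set"
  assumes "l \<noteq> 0"
  shows "indicator ((\<lambda>x. l *\<^sub>R x) ` E) (l *\<^sub>R x) = indicator E x"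
  using assms by (auto simp: indicator_def image_iff)

text \<open>Pulling a test field back by the dilation keeps it bounded by 1 and brings out the
  factor l^(d-1), at most 1 for a contraction. Hence restoring the volume by shrinking costs no
  perimeter.\<close>

lemma perimeter_dilation_le:
  fixes E :: "'a::euclidean_space set"
  assumes E: "compact E" and l: "0 < l" "l \<le> 1"
  shows "perimeter ((\<lambda>x. l *\<^sub>R x) ` E) \<le> perimeter E"
proof -
  let ?F = "(\<lambda>x. l *\<^sub>R x) ` E"
  have "compact ?F" by (intro compact_continuous_image continuous_intros E)
  then have F: "?F \<in> sets borel" by (simp add: borel_compact)
  have E': "E \<in> sets borel" using E by (simp add: borel_compact)
  show ?thesis
  proof (rule perimeter_leI[OF F])
    fix \<phi> :: "'a \<Rightarrow> 'a" assume \<phi>: "\<phi> \<in> C1c_fields" and le1: "\<And>x. norm (\<phi> x) \<le> 1"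
    let ?\<psi> = "\<lambda>x. \<phi> (l *\<^sub>R x)"
    let ?I = "LBINT x:E. divergence ?\<psi> x"
    have DIM: "l ^ DIM('a) = l * l ^ (DIM('a) - 1)"
      by (cases "DIM('a)") auto
    have "(LBINT x:?F. divergence \<phi> x) =
        \<bar>l\<bar> ^ DIM('a) * (LBINT x. indicator ?F (l *\<^sub>R x) *\<^sub>R divergence \<phi> (l *\<^sub>R x))"
      unfolding set_lebesgue_integral_def
      using l F borel_measurable_integrable[OF C1c_field_divergence(3)[OF \<phi>]]
      by (intro lborel_integral_scaleR) auto
    also have "\<dots> = l ^ (DIM('a) - 1) * ?I"
      using l by (simp add: indicator_scaleR_image C1c_fields_dilation(2)[OF \<phi>] set_lebesgue_integral_def DIM
          mult.left_commute[of _ l])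
    finally have eq: "(LBINT x:?F. divergence \<phi> x) = l ^ (DIM('a) - 1) * ?I" .
    \<comment> \<open>A negative \<open>?I\<close> may grow under multiplication by the factor, but
      then both sides are truncated to 0.\<close>
    have "ennreal (l ^ (DIM('a) - 1) * ?I) \<le> ennreal ?I"
    proof (cases "?I \<ge> 0")
      case True
      then show ?thesis using l by (intro ennreal_leI mult_left_le_one_le power_le_one) auto
    next
      case False
      then have "l ^ (DIM('a) - 1) * ?I \<le> 0" using l by (intro mult_nonneg_nonpos) auto
      then show ?thesis by (simp add: ennreal_neg)
    qed
    also have "\<dots> \<le> perimeter E"
      by (intro divergence_le_perimeter C1c_fields_dilation(1)[OF \<phi>] E' le1 l)
    finally show "ennreal (LBINT x:?F. divergence \<phi> x) \<le> perimeter E" unfolding eq .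
  qed
qed

lemma content_dilation:
  fixes E :: "'a::euclidean_space set"
  assumes "compact E" and l: "0 < l"
  shows "measure lborel ((\<lambda>x. l *\<^sub>R x) ` E) = l ^ DIM('a) * measure lborel E"
proof -
  have "compact ((\<lambda>x. l *\<^sub>R x) ` E)" by (intro compact_continuous_image continuous_intros assms)
  then have F: "(\<lambda>x. l *\<^sub>R x) ` E \<in> sets borel" by (simp add: borel_compact)
  have "measure lborel ((\<lambda>x. l *\<^sub>R x) ` E) = (LBINT x. indicator ((\<lambda>x. l *\<^sub>R x) ` E) x)" by simp
  also have "\<dots> = \<bar>l\<bar> ^ DIM('a) * (LBINT x. indicator ((\<lambda>x. l *\<^sub>R x) ` E) (l *\<^sub>R x))"
    using F l by (intro lborel_integral_scaleR) auto
  also have "\<dots> = l ^ DIM('a) * measure lborel E"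
    using l by (simp add: indicator_scaleR_image)
  finally show ?thesis .
qed

section \<open>Riesz energy\<close>

definition riesz_kernel :: "real \<Rightarrow> 'a::euclidean_space \<Rightarrow> 'a \<Rightarrow> ennreal" where
  "riesz_kernel \<alpha> x y = 1 / ennreal (dist x y powr \<alpha>)"

definition measure_energy :: "real \<Rightarrow> 'a::euclidean_space measure \<Rightarrow> ennreal" where
  "measure_energy \<alpha> \<mu> = (\<integral>\<^sup>+ y. (\<integral>\<^sup>+ x. riesz_kernel \<alpha> x y \<partial>\<mu>) \<partial>\<mu>)"

lemma riesz_kernel_commute: "riesz_kernel \<alpha> x y = riesz_kernel \<alpha> y x"
  by (simp add: riesz_kernel_def dist_commute)

lemma riesz_kernel_diag: "riesz_kernel \<alpha> x x = \<infinity>"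
  by (simp add: riesz_kernel_def)

lemma riesz_kernel_off_diag: "x \<noteq> y \<Longrightarrow> riesz_kernel \<alpha> x y = ennreal (dist x y powr - \<alpha>)"
  by (simp add: riesz_kernel_def powr_minus_divide divide_ennreal flip: ennreal_1)

lemma riesz_kernel_le:
  assumes "0 < t" "t \<le> dist x y" "0 \<le> \<alpha>"
  shows "riesz_kernel \<alpha> x y \<le> ennreal (t powr - \<alpha>)"
proof -
  have "x \<noteq> y" using assms by auto
  then show ?thesis
    using assms by (simp add: riesz_kernel_off_diag ennreal_leI powr_mono2')
qed

lemma riesz_kernel_ge:
  assumes "dist x y \<le> t" "0 \<le> \<alpha>"
  shows "ennreal (t powr - \<alpha>) \<le> riesz_kernel \<alpha> x y"
proof (cases "x = y")
  case False
  then show ?thesis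
    using assms by (simp add: riesz_kernel_off_diag ennreal_leI powr_mono2')
qed (simp add: riesz_kernel_diag)

lemma riesz_kernel_scaleR:
  assumes "l > 0"
  shows "riesz_kernel \<alpha> (l *\<^sub>R x) (l *\<^sub>R y) = ennreal (l powr - \<alpha>) * riesz_kernel \<alpha> x y"
proof (cases "x = y")
  case True
  then show ?thesis using assms by (simp add: riesz_kernel_diag ennreal_mult_top)
next
  case False
  moreover have "dist (l *\<^sub>R x) (l *\<^sub>R y) = l * dist x y"
    using assms by (simp add: dist_norm flip: scaleR_diff_right)
  ultimately show ?thesis
    using assms by (simp add: riesz_kernel_off_diag powr_mult ennreal_mult)
qed

lemma measurable_riesz_kernel [measurable (raw)]:
  fixes f g :: "'b \<Rightarrow> 'a::euclidean_space"
  assumes [measurable]: "f \<in> borel_measurable M" "g \<in> borel_measurable M"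
  shows "(\<lambda>x. riesz_kernel \<alpha> (f x) (g x)) \<in> borel_measurable M"
  unfolding riesz_kernel_def by measurable

lemma cball_borel [measurable]: "cball (c::'a::euclidean_space) r \<in> sets borel"
  by (simp add: borel_closed)

section \<open>Local integrability of the Riesz kernel\<close>

lemma ennreal_le_suminf: "f k \<le> (\<Sum>k. f k)" for f :: "nat \<Rightarrow> ennreal"
  using ennreal_suminf_lessD[of f "f k" k] by (cases "suminf f < f k") (auto simp: not_less)

text \<open>Dyadic decomposition: where 2^-(k+1) < |w| \<le> 2^-k the kernel is at most
  2^(\<alpha>(k+1)), and the ball of radius 2^-k has volume proportional to 2^(-kd). The
  contributions form a geometric series of ratio 2^(\<alpha>-d) < 1.\<close>

lemma nn_integral_riesz_kernel_cball_1_finite: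
  fixes \<alpha> :: real
  assumes \<alpha>: "0 < \<alpha>" "\<alpha> < DIM('a::euclidean_space)"
  shows "(\<integral>\<^sup>+w\<in>cball 0 1. riesz_kernel \<alpha> (0::'a) w \<partial>lborel) < \<infinity>"
proof -
  define q :: real where "q = 2 powr (\<alpha> - DIM('a))"
  have q: "0 < q" "q < 1" using \<alpha> by (auto simp: q_def powr_less_one)
  let ?w = "unit_ball_vol DIM('a)"
  let ?f = "\<lambda>k (w::'a). ennreal (2 powr (\<alpha> * Suc k)) * indicator (cball 0 ((1/2) ^ k)) w"
  have "(\<integral>\<^sup>+w\<in>cball 0 1. riesz_kernel \<alpha> (0::'a) w \<partial>lborel) \<le> (\<integral>\<^sup>+w. (\<Sum>k. ?f k w) \<partial>lborel)"
  proof (rule nn_integral_mono_AE)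
    have le: "riesz_kernel \<alpha> 0 w * indicator (cball 0 1) w \<le> (\<Sum>k. ?f k w)" if w: "w \<noteq> 0" for w
    proof (cases "norm w \<le> 1")
      case True
      obtain n where n: "(1/2) ^ n < norm w"
        using real_arch_pow_inv[of "norm w" "1/2"] w by auto
      \<comment> \<open>The first dyadic radius below \<open>norm w\<close>. Since
        \<open>norm w \<le> 1\<close> its index is not 0, and the predecessor \<open>k\<close>
        labels the dyadic shell containing \<open>w\<close>.\<close>
      define m where "m = (LEAST n. (1/2) ^ n < norm w)"
      have m: "(1/2) ^ m < norm w" unfolding m_def by (rule LeastI[of _ n]) (rule n)
      have "m \<noteq> 0" using m True by (cases m) auto
      then obtain k where k: "m = Suc k" by (cases m) auto
      have "\<not> (1/2) ^ k < norm w"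
        using not_less_Least[of k "\<lambda>n. (1/2) ^ n < norm w"] k unfolding m_def by simp
      then have mem: "w \<in> cball 0 ((1/2) ^ k)" by simp
      have "riesz_kernel \<alpha> 0 w \<le> ennreal (((1/2) ^ m) powr - \<alpha>)"
        using m \<alpha> by (intro riesz_kernel_le) auto
      also have "((1/2::real) ^ m) powr - \<alpha> = 2 powr (\<alpha> * Suc k)"
        by (simp add: k powr_realpow[symmetric] powr_powr powr_divide powr_minus_divide mult.commute
            del: powr_realpow power_Suc of_nat_Suc)
      also have "ennreal (2 powr (\<alpha> * Suc k)) = ?f k w" using mem by simp
      also have "\<dots> \<le> (\<Sum>k. ?f k w)"
        by (rule ennreal_le_suminf)
      finally show ?thesis using True by simp
    qed simp
    have "AE w in lborel. w \<noteq> (0::'a)" by (rule AE_lborel_singleton)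
    then show "AE w in lborel. riesz_kernel \<alpha> 0 w * indicator (cball 0 1) w \<le> (\<Sum>k. ?f k w)"
      by eventually_elim (rule le)
  qed
  also have "\<dots> = (\<Sum>k. \<integral>\<^sup>+w. ?f k w \<partial>lborel)"
    by (rule nn_integral_suminf) simp
  also have "\<dots> = (\<Sum>k. ennreal (2 powr \<alpha> * ?w * q ^ k))"
  proof (rule suminf_cong)
    fix k
    have "(\<integral>\<^sup>+w. ?f k w \<partial>lborel) = ennreal (2 powr (\<alpha> * Suc k)) * ennreal (?w * ((1/2) ^ k) ^ DIM('a))"
      by (subst nn_integral_cmult_indicator) (auto simp: emeasure_cball)
    also have "\<dots> = ennreal (2 powr (\<alpha> * Suc k) * (?w * ((1/2) ^ k) ^ DIM('a)))"
      by (simp add: ennreal_mult)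
    also have "2 powr (\<alpha> * Suc k) * (?w * ((1/2) ^ k) ^ DIM('a)) = 2 powr \<alpha> * ?w * q ^ k"
    proof -
      have "((1/2::real) ^ k) ^ DIM('a) = 2 powr (- (real DIM('a) * k))"
        by (simp add: powr_minus_divide powr_realpow[symmetric] powr_powr power_divide mult.commute
            flip: power_mult)
      moreover have "q ^ k = 2 powr ((\<alpha> - DIM('a)) * k)"
        using q by (simp add: q_def powr_realpow[symmetric] powr_powr)
      ultimately show ?thesis by (simp add: algebra_simps powr_add[symmetric])
    qed
    finally show "(\<integral>\<^sup>+w. ?f k w \<partial>lborel) = ennreal (2 powr \<alpha> * ?w * q ^ k)" .
  qed
  also have "\<dots> = ennreal (\<Sum>k. 2 powr \<alpha> * ?w * q ^ k)"
    using q by (intro suminf_ennreal2 summable_mult summable_geometric) auto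
  also have "\<dots> < \<infinity>" by simp
  finally show ?thesis .
qed

text \<open>Uniform in the pole \<open>q\<close>, wherever it lies: at distance more than
  \<open>r\<close> from \<open>q\<close> the kernel is at most r^(-\<alpha>), and the remaining
  points lie in \<open>cball q r\<close>, which translation and scaling reduce to the unit ball. The
  constant is the volume of the unit ball plus the integral \<open>J\<close>.\<close>

lemma nn_integral_riesz_kernel_cball_le:
  fixes \<alpha> :: real
  assumes \<alpha>: "0 < \<alpha>" "\<alpha> < DIM('a::euclidean_space)"
  obtains C :: real where "C > 0"
    "\<forall>r>0. \<forall>p q::'a. (\<integral>\<^sup>+w\<in>cball p r. riesz_kernel \<alpha> q w \<partial>lborel) \<le> ennreal (C * r powr (DIM('a) - \<alpha>))"
proof -
  let ?w = "unit_ball_vol DIM('a)"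
  obtain J where J: "J \<ge> 0" "(\<integral>\<^sup>+w\<in>cball 0 1. riesz_kernel \<alpha> (0::'a) w \<partial>lborel) = ennreal J"
    using nn_integral_riesz_kernel_cball_1_finite[OF \<alpha>] by (cases rule: ennreal_cases) auto
  have w: "?w > 0" by simp
  have "(\<integral>\<^sup>+w\<in>cball p r. riesz_kernel \<alpha> q w \<partial>lborel) \<le> ennreal ((?w + J) * r powr (DIM('a) - \<alpha>))"
    if r: "r > 0" for r and p q :: 'a
  proof -
    have pw: "r ^ DIM('a) * r powr - \<alpha> = r powr (DIM('a) - \<alpha>)"
      using r by (simp add: powr_realpow[symmetric] powr_add[symmetric])
    have "(\<integral>\<^sup>+w\<in>cball p r. riesz_kernel \<alpha> q w \<partial>lborel) \<le>
      (\<integral>\<^sup>+w. ennreal (r powr - \<alpha>) * indicator (cball p r) w + riesz_kernel \<alpha> q w * indicator (cball q r) w \<partial>lborel)"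
    proof (rule nn_integral_mono)
      fix w
      show "riesz_kernel \<alpha> q w * indicator (cball p r) w \<le>
        ennreal (r powr - \<alpha>) * indicator (cball p r) w + riesz_kernel \<alpha> q w * indicator (cball q r) w"
      proof (cases "w \<in> cball q r")
        case True
        have "riesz_kernel \<alpha> q w * indicator (cball p r) w \<le> riesz_kernel \<alpha> q w * 1"
          by (intro mult_left_mono) (auto simp: indicator_def)
        then show ?thesis using True by (simp add: add_increasing)
      next
        case False
        then have "riesz_kernel \<alpha> q w \<le> ennreal (r powr - \<alpha>)"
          using r \<alpha> by (intro riesz_kernel_le) auto
        then show ?thesis using False by (simp add: mult_right_mono)
      qed
    qed
    also have "\<dots> = ennreal (r powr - \<alpha>) * ennreal (?w * r ^ DIM('a))
      + (\<integral>\<^sup>+w\<in>cball q r. riesz_kernel \<alpha> q w \<partial>lborel)"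
      using r by (subst nn_integral_add) (auto simp: emeasure_cball nn_integral_cmult_indicator)
    also have "(\<integral>\<^sup>+w\<in>cball q r. riesz_kernel \<alpha> q w \<partial>lborel) =
      (\<integral>\<^sup>+w. riesz_kernel \<alpha> q (q + w) * indicator (cball q r) (q + w) \<partial>lborel)"
    proof -
      have "(\<integral>\<^sup>+w. riesz_kernel \<alpha> q w * indicator (cball q r) w \<partial>distr lborel borel ((+) q)) =
        (\<integral>\<^sup>+w. riesz_kernel \<alpha> q (q + w) * indicator (cball q r) (q + w) \<partial>lborel)"
        by (rule nn_integral_distr) measurable
      then show ?thesis by (simp only: lborel_distr_plus)
    qed
    also have "\<dots> = (\<integral>\<^sup>+w. riesz_kernel \<alpha> (0::'a) w * indicator (cball 0 r) w \<partial>lborel)"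
      by (rule nn_integral_cong) (auto simp: riesz_kernel_def dist_norm indicator_def)
    also have "\<dots> = ennreal (\<bar>r\<bar> ^ DIM('a)) *
      (\<integral>\<^sup>+w. riesz_kernel \<alpha> (0::'a) (r *\<^sub>R w) * indicator (cball 0 r) (r *\<^sub>R w) \<partial>lborel)"
      using r by (intro lborel_nn_integral_scaleR) auto
    also have "(\<integral>\<^sup>+w. riesz_kernel \<alpha> (0::'a) (r *\<^sub>R w) * indicator (cball 0 r) (r *\<^sub>R w) \<partial>lborel)
      = (\<integral>\<^sup>+w. ennreal (r powr - \<alpha>) * (riesz_kernel \<alpha> (0::'a) w * indicator (cball 0 1) w) \<partial>lborel)"
    proof (rule nn_integral_cong)
      fix w :: 'a
      show "riesz_kernel \<alpha> (0::'a) (r *\<^sub>R w) * indicator (cball 0 r) (r *\<^sub>R w) =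
        ennreal (r powr - \<alpha>) * (riesz_kernel \<alpha> (0::'a) w * indicator (cball 0 1) w)"
        using riesz_kernel_scaleR[OF r, of \<alpha> 0 w] r by (auto simp: indicator_def mult.assoc)
    qed
    also have "\<dots> = ennreal (r powr - \<alpha>) * ennreal J"
      by (subst nn_integral_cmult) (auto simp: J)
    also have "ennreal (r powr - \<alpha>) * ennreal (?w * r ^ DIM('a)) + ennreal (\<bar>r\<bar> ^ DIM('a)) * (ennreal (r powr - \<alpha>) * ennreal J)
      = ennreal ((?w + J) * (r ^ DIM('a) * r powr - \<alpha>))"
      using r J(1) w by (simp add: algebra_simps flip: ennreal_mult ennreal_plus)
    finally show ?thesis unfolding pw .
  qed
  moreover have "?w + J > 0" using J(1) w by linarith
  ultimately show ?thesis by (intro that[of "?w + J"]) auto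
qed

text \<open>Admissible charges are normalised on \<open>E\<close> only and may be wild elsewhere.
  Restriction to \<open>E\<close> turns them into probability measures, for which product measures
  and averaging are available, and it cannot raise the energy because the kernel is
  nonnegative.\<close>

lemma measure_energy_restrict:
  fixes \<mu> :: "'a::euclidean_space measure"
  assumes \<mu>: "sets \<mu> = sets borel" "emeasure \<mu> E = 1" and E: "E \<in> sets borel"
  obtains \<nu> where "sets \<nu> = sets borel" "prob_space \<nu>" "emeasure \<nu> E = 1"
    "measure_energy \<alpha> \<nu> \<le> measure_energy \<alpha> \<mu>"
proof -
  define \<nu> where "\<nu> = density \<mu> (indicator E)"
  have [measurable_cong]: "sets \<mu> = sets borel" "sets \<nu> = sets borel" using \<mu> by (auto simp: \<nu>_def)
  have sp: "space \<mu> = UNIV" using sets_eq_imp_space_eq[OF \<mu>(1)] by simp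
  have [measurable]: "E \<in> sets borel" by fact
  have em: "emeasure \<nu> X = emeasure \<mu> (E \<inter> X)" if "X \<in> sets borel" for X
    unfolding \<nu>_def using that E \<mu>
    by (subst emeasure_restricted) (auto simp: Int_commute)
  have 1: "emeasure \<nu> E = 1" using em[OF E] \<mu> by simp
  have "space \<nu> = UNIV" using sp by (simp add: \<nu>_def)
  then have 2: "prob_space \<nu>" using em[of UNIV] \<mu> by (intro prob_spaceI) simp
  interpret \<nu>: prob_space \<nu> by (rule 2)
  \<comment> \<open>Only \<open>f\<close> is taken measurable: \<open>g\<close> will be the
    potential of \<open>\<mu>\<close>, whose measurability is not clear when \<open>\<mu>\<close> is
    not sigma-finite.\<close>
  have nn: "(\<integral>\<^sup>+x. f x \<partial>\<nu>) \<le> (\<integral>\<^sup>+x. g x \<partial>\<mu>)"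
    if [measurable]: "f \<in> borel_measurable borel" and le: "\<And>x. f x \<le> g x" for f g
  proof -
    have "(\<integral>\<^sup>+x. f x \<partial>\<nu>) = (\<integral>\<^sup>+x. indicator E x * f x \<partial>\<mu>)"
      unfolding \<nu>_def by (subst nn_integral_density) auto
    also have "\<dots> \<le> (\<integral>\<^sup>+x. g x \<partial>\<mu>)"
      using le by (intro nn_integral_mono) (auto simp: indicator_def)
    finally show ?thesis .
  qed
  have "measure_energy \<alpha> \<nu> \<le> measure_energy \<alpha> \<mu>"
    unfolding measure_energy_def
  proof (rule nn)
    show "(\<lambda>y. \<integral>\<^sup>+ x. riesz_kernel \<alpha> x y \<partial>\<nu>) \<in> borel_measurable borel" by measurable
    show "(\<integral>\<^sup>+ x. riesz_kernel \<alpha> x y \<partial>\<nu>) \<le> (\<integral>\<^sup>+ x. riesz_kernel \<alpha> x y \<partial>\<mu>)" for y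
      by (rule nn) auto
  qed
  then show ?thesis using 1 2 \<open>sets \<nu> = sets borel\<close> by (intro that[of \<nu>])
qed

lemma riesz_energy_eq_INF:
  "riesz_energy \<alpha> E = (INF \<mu> \<in> {\<mu>. sets \<mu> = sets borel \<and> emeasure \<mu> E = 1}. measure_energy \<alpha> \<mu>)"
  by (simp add: riesz_energy_def measure_energy_def riesz_kernel_def)

lemma riesz_energy_le:
  assumes "sets \<mu> = sets borel" "emeasure \<mu> E = 1"
  shows "riesz_energy \<alpha> E \<le> measure_energy \<alpha> \<mu>"
  unfolding riesz_energy_eq_INF using assms by (intro INF_lower) auto

lemma riesz_energy_lessE:
  fixes E :: "'a::euclidean_space set"
  assumes "riesz_energy \<alpha> E < c" "E \<in> sets borel"
  obtains \<nu> where "sets \<nu> = sets borel" "prob_space \<nu>" "emeasure \<nu> E = 1" "measure_energy \<alpha> \<nu> < c"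
proof -
  have "\<exists>\<mu>\<in>{\<mu>. sets \<mu> = sets borel \<and> emeasure \<mu> E = 1}. measure_energy \<alpha> \<mu> < c"
    using assms(1) by (simp only: riesz_energy_eq_INF INF_less_iff)
  then obtain \<mu> where \<mu>: "sets \<mu> = sets borel" "emeasure \<mu> E = 1" "measure_energy \<alpha> \<mu> < c"
    by (elim bexE CollectE conjE)
  obtain \<nu> where "sets \<nu> = sets borel" "prob_space \<nu>" "emeasure \<nu> E = 1"
    "measure_energy \<alpha> \<nu> \<le> measure_energy \<alpha> \<mu>"
    by (rule measure_energy_restrict[OF \<mu>(1,2) assms(2)])
  then show ?thesis using \<mu>(3) by (intro that[of \<nu>]) auto
qed

text \<open>An admissible charge for \<open>E\<close> may give \<open>G\<close> mass larger than 1
  and so be inadmissible for \<open>G\<close>. Passing to a probability measure concentrated on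
  \<open>E\<close> removes this obstacle.\<close>

lemma riesz_energy_antimono:
  fixes E :: "'a::euclidean_space set"
  assumes "E \<subseteq> G" "E \<in> sets borel" "G \<in> sets borel"
  shows "riesz_energy \<alpha> G \<le> riesz_energy \<alpha> E"
proof (rule dense_ge)
  fix c assume "riesz_energy \<alpha> E < c"
  then obtain \<nu> where \<nu>: "sets \<nu> = sets borel" "prob_space \<nu>" "emeasure \<nu> E = 1" "measure_energy \<alpha> \<nu> < c"
    by (rule riesz_energy_lessE[OF _ assms(2)])
  interpret prob_space \<nu> by (rule \<nu>(2))
  have "emeasure \<nu> E \<le> emeasure \<nu> G" using assms \<nu>(1) by (intro emeasure_mono) auto
  then have "emeasure \<nu> G = 1" using \<nu>(3) emeasure_le_1[of G] by auto
  then have "riesz_energy \<alpha> G \<le> measure_energy \<alpha> \<nu>" by (intro riesz_energy_le \<nu>(1))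
  with \<nu>(4) show "riesz_energy \<alpha> G \<le> c" by auto
qed

text \<open>Push an almost optimal charge forward; the kernel is homogeneous of degree -\<alpha>.
  The strict bound \<open>c\<close> leaves the room that an almost optimal charge takes.\<close>

lemma riesz_energy_dilation_le:
  fixes E :: "'a::euclidean_space set"
  assumes E: "compact E" and l: "l > 0" and c: "riesz_energy \<alpha> E < c"
  shows "riesz_energy \<alpha> ((\<lambda>x. l *\<^sub>R x) ` E) \<le> ennreal (l powr - \<alpha>) * c"
proof -
  have E': "E \<in> sets borel" using E by (simp add: borel_compact)
  have "compact ((\<lambda>x. l *\<^sub>R x) ` E)" by (intro compact_continuous_image continuous_intros E)
  then have F: "(\<lambda>x. l *\<^sub>R x) ` E \<in> sets borel" by (simp add: borel_compact)
  obtain \<nu> where \<nu>: "sets \<nu> = sets borel" "prob_space \<nu>" "emeasure \<nu> E = 1" "measure_energy \<alpha> \<nu> < c"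
    by (rule riesz_energy_lessE[OF c E'])
  interpret prob_space \<nu> by (rule \<nu>(2))
  have [measurable_cong]: "sets \<nu> = sets borel" by fact
  have sp: "space \<nu> = UNIV" using sets_eq_imp_space_eq[OF \<nu>(1)] by simp
  define \<rho> where "\<rho> = distr \<nu> borel (\<lambda>x. l *\<^sub>R x)"
  interpret \<rho>: prob_space \<rho> unfolding \<rho>_def by (rule prob_space_distr) measurable
  have [measurable_cong]: "sets \<rho> = sets borel" by (simp add: \<rho>_def)
  have transfer: "(\<integral>\<^sup>+y. f y \<partial>\<rho>) = (\<integral>\<^sup>+y. f (l *\<^sub>R y) \<partial>\<nu>)" if "f \<in> borel_measurable borel" for f
    unfolding \<rho>_def using that by (intro nn_integral_distr) measurable
  have "(\<lambda>x. l *\<^sub>R x) -` ((\<lambda>x. l *\<^sub>R x) ` E) = E"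
    using l by (intro inj_vimage_image_eq injI) auto
  then have "emeasure \<rho> ((\<lambda>x. l *\<^sub>R x) ` E) = 1"
    unfolding \<rho>_def using F sp \<nu>(3) by (subst emeasure_distr) auto
  then have "riesz_energy \<alpha> ((\<lambda>x. l *\<^sub>R x) ` E) \<le> measure_energy \<alpha> \<rho>"
    by (intro riesz_energy_le) (auto simp: \<rho>_def)
  also have "measure_energy \<alpha> \<rho> = (\<integral>\<^sup>+ y. (\<integral>\<^sup>+ x. riesz_kernel \<alpha> x (l *\<^sub>R y) \<partial>\<rho>) \<partial>\<nu>)"
    unfolding measure_energy_def by (rule transfer) measurable
  also have "\<dots> = (\<integral>\<^sup>+ y. (\<integral>\<^sup>+ x. riesz_kernel \<alpha> (l *\<^sub>R x) (l *\<^sub>R y) \<partial>\<nu>) \<partial>\<nu>)"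
    by (intro nn_integral_cong transfer) measurable
  also have "\<dots> = ennreal (l powr - \<alpha>) * measure_energy \<alpha> \<nu>"
    unfolding measure_energy_def riesz_kernel_scaleR[OF l]
    by (simp add: nn_integral_cmult)
  also have "\<dots> \<le> ennreal (l powr - \<alpha>) * c" using \<nu>(4) by (intro mult_left_mono) auto
  finally show ?thesis .
qed

text \<open>The uniform distribution on \<open>E\<close> has bounded potential, since
  \<open>E\<close> lies in a ball and the kernel is integrable on balls uniformly in its
  pole.\<close>

lemma riesz_energy_finite:
  fixes E :: "'a::euclidean_space set" and \<alpha> :: real
  assumes E: "compact E" and pos: "measure lborel E > 0" and \<alpha>: "0 < \<alpha>" "\<alpha> < DIM('a)"
  shows "riesz_energy \<alpha> E < \<infinity>"
proof -
  have [measurable]: "E \<in> sets borel" using E by (simp add: borel_compact)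
  have fin: "emeasure lborel E < \<infinity>" by (rule emeasure_compact_finite[OF E])
  define m where "m = measure lborel E"
  have m: "m > 0" "emeasure lborel E = ennreal m"
    using pos fin by (auto simp: m_def emeasure_eq_ennreal_measure less_top)
  obtain C :: real where C: "C > 0"
    "\<forall>r>0. \<forall>p q::'a. (\<integral>\<^sup>+w\<in>cball p r. riesz_kernel \<alpha> q w \<partial>lborel) \<le> ennreal (C * r powr (DIM('a) - \<alpha>))"
    by (rule nn_integral_riesz_kernel_cball_le[OF \<alpha>])
  obtain R where R: "R > 0" "\<forall>x\<in>E. norm x \<le> R"
    using compact_imp_bounded[OF E] unfolding bounded_pos by auto
  define B where "B = C * R powr (DIM('a) - \<alpha>)"
  define \<nu> where "\<nu> = density lborel (\<lambda>x. ennreal (1 / m) * indicator E x)"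
  have [measurable_cong]: "sets \<nu> = sets borel" by (simp add: \<nu>_def)
  have one: "emeasure \<nu> E = 1"
    unfolding \<nu>_def using m
    by (subst emeasure_density) (auto simp: mult.assoc nn_integral_cmult_indicator simp flip: ennreal_mult indicator_inter_arith)
  have inner: "(\<integral>\<^sup>+ x. riesz_kernel \<alpha> x y \<partial>\<nu>) \<le> ennreal (1 / m * B)" for y
  proof -
    have "(\<integral>\<^sup>+ x. riesz_kernel \<alpha> x y \<partial>\<nu>) =
        (\<integral>\<^sup>+ x. ennreal (1 / m) * (riesz_kernel \<alpha> x y * indicator E x) \<partial>lborel)"
      unfolding \<nu>_def by (subst nn_integral_density) (auto intro!: nn_integral_cong simp: mult_ac)
    also have "\<dots> = ennreal (1 / m) * (\<integral>\<^sup>+ x. riesz_kernel \<alpha> x y * indicator E x \<partial>lborel)"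
      by (rule nn_integral_cmult) measurable
    finally have eq: "(\<integral>\<^sup>+ x. riesz_kernel \<alpha> x y \<partial>\<nu>) =
      ennreal (1 / m) * (\<integral>\<^sup>+ x. riesz_kernel \<alpha> x y * indicator E x \<partial>lborel)" .
    have "(\<integral>\<^sup>+ x. riesz_kernel \<alpha> x y * indicator E x \<partial>lborel)
        \<le> (\<integral>\<^sup>+ x\<in>cball 0 R. riesz_kernel \<alpha> y x \<partial>lborel)"
      using R(2) by (intro nn_integral_mono) (auto simp: indicator_def riesz_kernel_commute[of _ y])
    also have "\<dots> \<le> ennreal B" unfolding B_def using C(2) R(1) by blast
    finally have "(\<integral>\<^sup>+ x. riesz_kernel \<alpha> x y \<partial>\<nu>) \<le> ennreal (1 / m) * ennreal B"
      unfolding eq by (rule mult_left_mono) simp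
    moreover have "ennreal (1 / m) * ennreal B = ennreal (1 / m * B)"
      using m C(1) by (intro ennreal_mult[symmetric]) (auto simp: B_def)
    ultimately show ?thesis by simp
  qed
  have "riesz_energy \<alpha> E \<le> measure_energy \<alpha> \<nu>"
    by (intro riesz_energy_le one) (simp add: \<nu>_def)
  also have "\<dots> \<le> (\<integral>\<^sup>+ y. ennreal (1 / m * B) \<partial>\<nu>)"
    unfolding measure_energy_def by (intro nn_integral_mono inner)
  also have "\<dots> = ennreal (1 / m * B) * emeasure \<nu> (space \<nu>)" by simp
  also have "emeasure \<nu> (space \<nu>) = ennreal (1 / m) * ennreal m"
    unfolding \<nu>_def using m by (subst emeasure_density) (auto simp: nn_integral_cmult_indicator)
  also have "ennreal (1 / m * B) * (ennreal (1 / m) * ennreal m) < \<infinity>"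
    by (simp add: ennreal_mult_less_top)
  finally show ?thesis .
qed

text \<open>Points of \<open>E\<close> are at most \<open>2 * R\<close> apart, which bounds the
  kernel from below. Positivity turns the relative gain from a dilation into an absolute
  one.\<close>

lemma riesz_energy_pos:
  fixes E :: "'a::euclidean_space set"
  assumes E: "compact E" and \<alpha>: "0 < \<alpha>"
  shows "riesz_energy \<alpha> E > 0"
proof -
  have [measurable]: "E \<in> sets borel" using E by (simp add: borel_compact)
  obtain R where R: "R > 0" "\<forall>x\<in>E. norm x \<le> R"
    using compact_imp_bounded[OF E] unfolding bounded_pos by auto
  let ?c = "ennreal ((2 * R) powr - \<alpha>)"
  have "?c \<le> riesz_energy \<alpha> E"
    unfolding riesz_energy_eq_INF
  proof (rule INF_greatest)
    fix \<mu> :: "'a measure" assume "\<mu> \<in> {\<mu>. sets \<mu> = sets borel \<and> emeasure \<mu> E = 1}"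
    then have s: "sets \<mu> = sets borel" and 1: "emeasure \<mu> E = 1" by auto
    have [measurable_cong]: "sets \<mu> = sets borel" by fact
    have ker: "?c \<le> riesz_kernel \<alpha> x y" if "x \<in> E" "y \<in> E" for x y
    proof (rule riesz_kernel_ge)
      have "norm x \<le> R" "norm y \<le> R" using that R(2) by auto
      then show "dist x y \<le> 2 * R" using dist_triangle2[of x y 0] by simp
    qed (use \<alpha> in simp)
    have "?c = (\<integral>\<^sup>+ y. ?c * indicator E y \<partial>\<mu>)"
      using 1 by (subst nn_integral_cmult_indicator) auto
    also have "\<dots> \<le> measure_energy \<alpha> \<mu>"
      unfolding measure_energy_def
    proof (rule nn_integral_mono)
      fix y
      show "?c * indicator E y \<le> (\<integral>\<^sup>+ x. riesz_kernel \<alpha> x y \<partial>\<mu>)"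
      proof (cases "y \<in> E")
        case True
        have "?c = (\<integral>\<^sup>+ x. ?c * indicator E x \<partial>\<mu>)"
          using 1 by (subst nn_integral_cmult_indicator) auto
        also have "\<dots> \<le> (\<integral>\<^sup>+ x. riesz_kernel \<alpha> x y \<partial>\<mu>)"
          using ker True by (intro nn_integral_mono) (auto simp: indicator_def)
        finally show ?thesis using True by simp
      qed simp
    qed
    finally show "?c \<le> measure_energy \<alpha> \<mu>" .
  qed
  moreover have "?c > 0" using R(1) by simp
  ultimately show ?thesis by (rule less_le_trans[rotated])
qed

section \<open>Energy of clouds of small balls\<close>

text \<open>First-moment principle: a function exceeding its mean throughout a set of full measure
  would have an integral larger than itself. The point is found inside \<open>E\<close>, where the
  centres of the balls must lie.\<close>

lemma (in prob_space) exists_le_nn_integral: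
  assumes E: "E \<in> sets M" "emeasure M E = 1" and [measurable]: "f \<in> borel_measurable M"
  shows "\<exists>z\<in>E. f z \<le> integral\<^sup>N M f"
proof (rule ccontr)
  assume "\<not> ?thesis"
  then have gt: "\<forall>z\<in>E. integral\<^sup>N M f < f z" by (auto simp: not_le)
  have "E \<noteq> {}" using E by auto
  then have fin: "integral\<^sup>N M f \<noteq> \<infinity>" using gt by auto
  have AE: "AE z in M. z \<in> E"
    using E by (subst AE_in_set_eq_1) (auto simp: emeasure_eq_measure)
  let ?c = "integral\<^sup>N M f"
  have "(\<integral>\<^sup>+z. ?c \<partial>M) < integral\<^sup>N M f"
  proof (rule nn_integral_less)
    show "(\<integral>\<^sup>+z. ?c \<partial>M) \<noteq> \<infinity>" using fin by (simp add: emeasure_space_1)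
    show "AE z in M. ?c \<le> f z" using AE by eventually_elim (use gt in auto)
    show "\<not> (AE z in M. f z \<le> ?c)"
    proof
      assume "AE z in M. f z \<le> ?c"
      with AE have "AE z in M. False" by eventually_elim (use gt in \<open>auto simp: not_le[symmetric]\<close>)
      then show False by simp
    qed
  qed auto
  then show False by (simp add: emeasure_space_1)
qed

text \<open>Averaging over independent points of law \<open>M\<close>, made constructive: the points are fixed one
  at a time, each chosen point contributing its potential to the external field \<open>g\<close>.\<close>

lemma (in prob_space) exists_points_pair_sum_le:
  fixes H :: "'a \<times> 'a \<Rightarrow> ennreal"
  assumes E: "E \<in> sets M" "emeasure M E = 1"
    and [measurable]: "H \<in> borel_measurable (M \<Otimes>\<^sub>M M)" "g \<in> borel_measurable M"
  shows "\<exists>x. (\<forall>i<N. x i \<in> E) \<and> (\<Sum>i<N. \<Sum>j<i. H (x i, x j)) + (\<Sum>i<N. g (x i))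
    \<le> of_nat (\<Sum>i<N. i) * (\<integral>\<^sup>+z. \<integral>\<^sup>+y. H (z, y) \<partial>M \<partial>M) + of_nat N * integral\<^sup>N M g"
  using assms(4)
proof (induction N arbitrary: g)
  case (Suc N)
  note [measurable] = Suc.prems
  let ?e = "\<integral>\<^sup>+z. \<integral>\<^sup>+y. H (z, y) \<partial>M \<partial>M"
  \<comment> \<open>The quantity to be made small by the next point: its field value plus its
    expected interaction with the \<open>N\<close> points still to be chosen.\<close>
  have "\<exists>z\<in>E. g z + of_nat N * (\<integral>\<^sup>+y. H (z, y) \<partial>M) \<le>
      (\<integral>\<^sup>+z. g z + of_nat N * (\<integral>\<^sup>+y. H (z, y) \<partial>M) \<partial>M)"
    by (rule exists_le_nn_integral[OF E]) measurable
  also have "(\<integral>\<^sup>+z. g z + of_nat N * (\<integral>\<^sup>+y. H (z, y) \<partial>M) \<partial>M) = integral\<^sup>N M g + of_nat N * ?e"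
    by (simp add: nn_integral_add nn_integral_cmult)
  finally obtain z where z: "z \<in> E" "g z + of_nat N * (\<integral>\<^sup>+y. H (z, y) \<partial>M) \<le> integral\<^sup>N M g + of_nat N * ?e"
    by (elim bexE)
  have zs: "z \<in> space M" using z(1) sets.sets_into_space[OF E(1)] by auto
  have Hz [measurable]: "(\<lambda>y. H (z, y)) \<in> borel_measurable M" using zs by measurable
  obtain x where x: "\<forall>i<N. x i \<in> E" "(\<Sum>i<N. \<Sum>j<i. H (x i, x j)) + (\<Sum>i<N. g (x i) + H (z, x i))
    \<le> of_nat (\<Sum>i<N. i) * ?e + of_nat N * (\<integral>\<^sup>+y. g y + H (z, y) \<partial>M)"
    using Suc.IH[of "\<lambda>y. g y + H (z, y)"] by fastforce
  \<comment> \<open>The new point receives the last index \<open>N\<close>, so the terms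
    \<open>H (z, x i)\<close> absorbed in the field are exactly the pairs whose first index is
    \<open>N\<close>.\<close>
  define x' where "x' = x(N := z)"
  have x': "x' i = x i" if "i < N" for i using that by (simp add: x'_def)
  have x'N: "x' N = z" by (simp add: x'_def)
  have "(\<Sum>i<Suc N. \<Sum>j<i. H (x' i, x' j)) + (\<Sum>i<Suc N. g (x' i)) =
      ((\<Sum>i<N. \<Sum>j<i. H (x i, x j)) + (\<Sum>i<N. g (x i) + H (z, x i))) + g z"
    using x' x'N by (simp add: sum.distrib add_ac)
  also have "\<dots> \<le> (of_nat (\<Sum>i<N. i) * ?e + of_nat N * (\<integral>\<^sup>+y. g y + H (z, y) \<partial>M)) + g z"
    by (rule add_right_mono[OF x(2)])
  also have "\<dots> = of_nat (\<Sum>i<N. i) * ?e + of_nat N * integral\<^sup>N M g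
      + (g z + of_nat N * (\<integral>\<^sup>+y. H (z, y) \<partial>M))"
    by (simp add: nn_integral_add distrib_left add_ac)
  also have "\<dots> \<le> of_nat (\<Sum>i<N. i) * ?e + of_nat N * integral\<^sup>N M g + (integral\<^sup>N M g + of_nat N * ?e)"
    by (rule add_left_mono[OF z(2)])
  also have "\<dots> = of_nat (\<Sum>i<Suc N. i) * ?e + of_nat (Suc N) * integral\<^sup>N M g"
    by (simp add: distrib_right add_ac)
  finally have "(\<Sum>i<Suc N. \<Sum>j<i. H (x' i, x' j)) + (\<Sum>i<Suc N. g (x' i))
      \<le> of_nat (\<Sum>i<Suc N. i) * ?e + of_nat (Suc N) * integral\<^sup>N M g" .
  moreover have "\<forall>i<Suc N. x' i \<in> E" using x(1) z(1) by (auto simp: x'_def less_Suc_eq)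
  ultimately show ?case by blast
qed simp

lemma sum_square_eq_diag_plus_pairs:
  fixes f :: "nat \<Rightarrow> nat \<Rightarrow> 'a::comm_monoid_add"
  shows "(\<Sum>i<N. \<Sum>j<N. f i j) = (\<Sum>i<N. f i i) + (\<Sum>i<N. \<Sum>j<i. f i j + f j i)"
  by (induction N) (simp_all add: sum.distrib add_ac)

text \<open>A finite energy does not charge the diagonal.\<close>

lemma energy_near_diagonal_small:
  fixes \<nu> :: "'a::euclidean_space measure"
  assumes "prob_space \<nu>" and s: "sets \<nu> = sets borel" and fin: "measure_energy \<alpha> \<nu> < \<infinity>" and "\<epsilon> > 0"
  obtains s where "s > 0"
    "(\<integral>\<^sup>+z. \<integral>\<^sup>+y. riesz_kernel \<alpha> z y * indicator {p. dist (fst p) (snd p) < s} (z, y) \<partial>\<nu> \<partial>\<nu>) < \<epsilon>"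
proof -
  interpret prob_space \<nu> by fact
  have [measurable_cong]: "sets \<nu> = sets borel" by fact
  let ?P = "\<nu> \<Otimes>\<^sub>M \<nu>"
  let ?K = "\<lambda>p. riesz_kernel \<alpha> (fst p) (snd p)"
  let ?f = "\<lambda>n p. ?K p * indicator {p. dist (fst p) (snd p) < 1 / real (Suc n)} p"
  have K: "?K \<in> borel_measurable ?P" by measurable
  have f: "?f n \<in> borel_measurable ?P" for n by measurable
  have KI: "integral\<^sup>N ?P ?K < \<infinity>"
  proof -
    have "integral\<^sup>N ?P ?K = (\<integral>\<^sup>+z. \<integral>\<^sup>+y. riesz_kernel \<alpha> z y \<partial>\<nu> \<partial>\<nu>)"
      using nn_integral_fst[OF K] by simp
    also have "\<dots> = measure_energy \<alpha> \<nu>"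
      unfolding measure_energy_def by (intro nn_integral_cong riesz_kernel_commute)
    finally show ?thesis using fin by simp
  qed
  have "AE p in ?P. ?K p \<noteq> \<infinity>" by (rule nn_integral_PInf_AE[OF K]) (use KI in simp)
  then have AE: "AE p in ?P. fst p \<noteq> snd p"
  proof eventually_elim
    fix p :: "'a \<times> 'a" assume "?K p \<noteq> \<infinity>"
    then show "fst p \<noteq> snd p" by (metis riesz_kernel_diag)
  qed
  have "(\<lambda>n. integral\<^sup>N ?P (?f n)) \<longlonglongrightarrow> integral\<^sup>N ?P (\<lambda>_. 0)"
  proof (rule nn_integral_dominated_convergence[where w="?K"])
    show "AE p in ?P. ?f n p \<le> ?K p" for n by (auto simp: indicator_def)
    show "AE p in ?P. (\<lambda>n. ?f n p) \<longlonglongrightarrow> 0"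
      using AE
    proof eventually_elim
      fix p :: "'a \<times> 'a" assume "fst p \<noteq> snd p"
      then have "dist (fst p) (snd p) > 0" by simp
      then have "\<forall>\<^sub>F n in sequentially. 1 / real (Suc n) < dist (fst p) (snd p)"
        using order_tendstoD(2)[OF LIMSEQ_inverse_real_of_nat] by (simp add: inverse_eq_divide)
      then have "\<forall>\<^sub>F n in sequentially. ?f n p = 0" by eventually_elim auto
      then show "(\<lambda>n. ?f n p) \<longlonglongrightarrow> 0" by (rule tendsto_eventually)
    qed
  qed (use K f KI in auto)
  then have "(\<lambda>n. integral\<^sup>N ?P (?f n)) \<longlonglongrightarrow> 0" by simp
  then have "\<forall>\<^sub>F n in sequentially. integral\<^sup>N ?P (?f n) < \<epsilon>" using \<open>\<epsilon> > 0\<close> by (rule order_tendstoD)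
  then obtain n where "integral\<^sup>N ?P (?f n) < \<epsilon>" by (auto simp: eventually_sequentially)
  then show ?thesis
    using nn_integral_fst[OF f[of n]] by (intro that[of "1 / real (Suc n)"]) auto
qed

section \<open>Interaction of uniformly charged balls\<close>

text \<open>Bounds the mutual energy of two uniformly charged balls of radius \<open>r\<close> (up to normalisation).\<close>

definition ball_kernel :: "real \<Rightarrow> real \<Rightarrow> real \<Rightarrow> real \<Rightarrow> 'a::euclidean_space \<times> 'a \<Rightarrow> ennreal" where
  "ball_kernel \<alpha> L C r p = (if L * r \<le> dist (fst p) (snd p)
     then ennreal ((1 - 2 / L) powr - \<alpha>) * riesz_kernel \<alpha> (fst p) (snd p)
     else ennreal (C * r powr - \<alpha>))"

lemma ball_kernel_measurable [measurable]:
  "ball_kernel \<alpha> L C r \<in> borel_measurable (borel \<Otimes>\<^sub>M (borel :: 'a::euclidean_space measure))"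
  unfolding ball_kernel_def by measurable

lemma ball_kernel_commute: "ball_kernel \<alpha> L C r (x, y) = ball_kernel \<alpha> L C r (y, x)"
  by (simp add: ball_kernel_def dist_commute riesz_kernel_commute)

lemma ball_kernel_diag: "L > 0 \<Longrightarrow> r > 0 \<Longrightarrow> ball_kernel \<alpha> L C r (x, x) = ennreal (C * r powr - \<alpha>)"
  by (simp add: ball_kernel_def mult_le_0_iff)

text \<open>The constant used for close pairs is C L^\<alpha> (L r)^(-\<alpha>), at most C
  L^\<alpha> times the kernel at distance below L r. As L r \<le> s, such pairs fall in the
  near-diagonal region, whose energy can be made small by the choice of \<open>s\<close>.\<close>

lemma ball_kernel_le:
  assumes "L > 2" "r > 0" "C > 0" "\<alpha> > 0" "L * r \<le> s"
  shows "ball_kernel \<alpha> L C r (x, y) \<le> ennreal ((1 - 2 / L) powr - \<alpha>) * riesz_kernel \<alpha> x y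
    + ennreal (C * L powr \<alpha>) * (riesz_kernel \<alpha> x y * indicator {p. dist (fst p) (snd p) < s} (x, y))"
proof (cases "L * r \<le> dist x y")
  case False
  then have "ennreal ((L * r) powr - \<alpha>) \<le> riesz_kernel \<alpha> x y"
    using assms by (intro riesz_kernel_ge) auto
  then have "ennreal (C * L powr \<alpha>) * ennreal ((L * r) powr - \<alpha>) \<le> ennreal (C * L powr \<alpha>) * riesz_kernel \<alpha> x y"
    by (rule mult_left_mono) simp
  moreover have "ennreal (C * L powr \<alpha>) * ennreal ((L * r) powr - \<alpha>) = ennreal (C * r powr - \<alpha>)"
    using assms by (simp add: ennreal_mult[symmetric] powr_mult powr_minus field_simps)
  ultimately show ?thesis using False assms(5)
    by (simp add: ball_kernel_def add_increasing)
qed (simp add: ball_kernel_def)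

text \<open>\<open>A\<close> is the volume of a ball. For distant centres, 2 r is at most the
  fraction 2/L of their distance, so points of the two balls keep the fraction 1 - 2/L of it. For
  close or equal centres, the potential of one ball is at most A C r^(-\<alpha>) everywhere;
  dividing the constant by the unit ball volume gives it this form.\<close>

lemma ball_ball_energy_le:
  fixes p q :: "'a::euclidean_space" and \<alpha> :: real
  assumes \<alpha>: "0 < \<alpha>" and L: "L > 2" and r: "r > 0" and C0: "C > 0"
    and C: "\<forall>r>0. \<forall>p q::'a. (\<integral>\<^sup>+w\<in>cball p r. riesz_kernel \<alpha> q w \<partial>lborel)
      \<le> ennreal (C * unit_ball_vol DIM('a) * r powr (DIM('a) - \<alpha>))"
  defines "A \<equiv> unit_ball_vol DIM('a) * r ^ DIM('a)"
  shows "(\<integral>\<^sup>+y\<in>cball q r. (\<integral>\<^sup>+x\<in>cball p r. riesz_kernel \<alpha> x y \<partial>lborel) \<partial>lborel)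
    \<le> ennreal (A * A) * ball_kernel \<alpha> L C r (p, q)"
proof -
  have A: "A > 0" using r by (simp add: A_def)
  have emb: "emeasure lborel (cball c r) = ennreal A" for c :: 'a
    using r by (simp add: emeasure_cball A_def)
  have int_le: "(\<integral>\<^sup>+y\<in>cball q r. f y \<partial>lborel) \<le> ennreal A * b" if "\<And>y. y \<in> cball q r \<Longrightarrow> f y \<le> b"
    for f :: "'a \<Rightarrow> ennreal" and b q
  proof -
    have "(\<integral>\<^sup>+y\<in>cball q r. f y \<partial>lborel) \<le> (\<integral>\<^sup>+y. b * indicator (cball q r) y \<partial>lborel)"
      using that by (intro nn_integral_mono) (auto simp: indicator_def)
    also have "\<dots> = ennreal A * b" by (simp add: nn_integral_cmult_indicator emb mult.commute)
    finally show ?thesis .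
  qed
  have "(\<integral>\<^sup>+x\<in>cball p r. riesz_kernel \<alpha> x y \<partial>lborel) \<le> ennreal A * ball_kernel \<alpha> L C r (p, q)"
    if y: "y \<in> cball q r" for y
  proof (cases "L * r \<le> dist p q")
    case True
    have t: "0 < 1 - 2 / L" using L by simp
    have "riesz_kernel \<alpha> x y \<le> ball_kernel \<alpha> L C r (p, q)" if x: "x \<in> cball p r" for x
    proof -
      have "0 < L * r" using L r by simp
      then have pq: "dist p q > 0" using True by linarith
      have "dist p q \<le> dist p x + dist x y + dist q y"
        using dist_triangle[of p q x] dist_triangle2[of x q y] by (simp add: dist_commute)
      moreover have "2 * r \<le> 2 / L * dist p q" using True L by (simp add: field_simps)
      ultimately have "(1 - 2 / L) * dist p q \<le> dist x y"
        using x y by (simp add: left_diff_distrib)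
      then have "riesz_kernel \<alpha> x y \<le> ennreal (((1 - 2 / L) * dist p q) powr - \<alpha>)"
        using \<alpha> t pq by (intro riesz_kernel_le) auto
      also have "\<dots> = ennreal ((1 - 2 / L) powr - \<alpha>) * riesz_kernel \<alpha> p q"
        using t pq by (simp add: powr_mult ennreal_mult riesz_kernel_off_diag)
      finally show ?thesis using True by (simp add: ball_kernel_def)
    qed
    then show ?thesis by (rule int_le)
  next
    case False
    have "(\<integral>\<^sup>+x\<in>cball p r. riesz_kernel \<alpha> x y \<partial>lborel) \<le>
        ennreal (C * unit_ball_vol DIM('a) * r powr (DIM('a) - \<alpha>))"
      using C r unfolding riesz_kernel_commute[of \<alpha> _ y] by blast
    also have "C * unit_ball_vol DIM('a) * r powr (DIM('a) - \<alpha>) = A * (C * r powr - \<alpha>)"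
      using r by (simp add: A_def powr_diff powr_minus powr_realpow field_simps)
    also have "ennreal \<dots> = ennreal A * ball_kernel \<alpha> L C r (p, q)"
      using False A C0 by (simp add: ball_kernel_def ennreal_mult)
    finally show ?thesis .
  qed
  then have "(\<integral>\<^sup>+y\<in>cball q r. (\<integral>\<^sup>+x\<in>cball p r. riesz_kernel \<alpha> x y \<partial>lborel) \<partial>lborel)
    \<le> ennreal A * (ennreal A * ball_kernel \<alpha> L C r (p, q))"
    by (rule int_le)
  then show ?thesis using A by (simp add: ennreal_mult mult.assoc)
qed

text \<open>Test with the charge that puts mass 1/N uniformly on every ball. The balls may overlap
  or coincide: densities are added, not united, so the mass on the union is still 1.\<close>

lemma riesz_energy_Union_cball_le:
  fixes x :: "nat \<Rightarrow> 'a::euclidean_space" and \<alpha> :: real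
  assumes \<alpha>: "0 < \<alpha>" and L: "L > 2" and r: "r > 0" and C0: "C > 0"
    and C: "\<forall>r>0. \<forall>p q::'a. (\<integral>\<^sup>+w\<in>cball p r. riesz_kernel \<alpha> q w \<partial>lborel)
      \<le> ennreal (C * unit_ball_vol DIM('a) * r powr (DIM('a) - \<alpha>))"
    and N: "N > 0"
  shows "riesz_energy \<alpha> (\<Union>i<N. cball (x i) r)
    \<le> ennreal (1 / (real N)\<^sup>2) * (\<Sum>i<N. \<Sum>j<N. ball_kernel \<alpha> L C r (x i, x j))"
proof -
  define A where "A = unit_ball_vol DIM('a) * r ^ DIM('a)"
  have A: "A > 0" using r by (simp add: A_def)
  have emb: "emeasure lborel (cball c r) = ennreal A" for c :: 'a
    using r by (simp add: emeasure_cball A_def)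
  define c where "c = 1 / (N * A)"
  have c: "c > 0" using A N by (simp add: c_def)
  define \<rho> where "\<rho> = density lborel (\<lambda>z. \<Sum>i<N. ennreal c * indicator (cball (x i) r) z)"
  have [measurable_cong]: "sets \<rho> = sets borel" by (simp add: \<rho>_def)
  have int\<rho>: "integral\<^sup>N \<rho> g = (\<Sum>i<N. ennreal c * (\<integral>\<^sup>+z\<in>cball (x i) r. g z \<partial>lborel))"
    if [measurable]: "g \<in> borel_measurable borel" for g
  proof -
    have "integral\<^sup>N \<rho> g = (\<integral>\<^sup>+z. (\<Sum>i<N. ennreal c * indicator (cball (x i) r) z) * g z \<partial>lborel)"
      unfolding \<rho>_def by (intro nn_integral_density) auto
    also have "\<dots> = (\<integral>\<^sup>+z. (\<Sum>i<N. ennreal c * (g z * indicator (cball (x i) r) z)) \<partial>lborel)"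
      by (intro nn_integral_cong, subst sum_distrib_right, rule sum.cong[OF refl], simp only: mult_ac)
    also have "\<dots> = (\<Sum>i<N. \<integral>\<^sup>+z. ennreal c * (g z * indicator (cball (x i) r) z) \<partial>lborel)"
      by (intro nn_integral_sum) auto
    also have "\<dots> = (\<Sum>i<N. ennreal c * (\<integral>\<^sup>+z\<in>cball (x i) r. g z \<partial>lborel))"
      by (intro sum.cong nn_integral_cmult) auto
    finally show ?thesis .
  qed
  let ?U = "\<Union>i<N. cball (x i) r"
  have U: "?U \<in> sets borel" by auto
  have "emeasure \<rho> ?U = integral\<^sup>N \<rho> (indicator ?U)" using U by (simp add: \<rho>_def)
  also have "\<dots> = (\<Sum>i<N. ennreal c * (\<integral>\<^sup>+z\<in>cball (x i) r. indicator ?U z \<partial>lborel))"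
    using U by (intro int\<rho>) auto
  also have "\<dots> = (\<Sum>i<N. ennreal c * ennreal A)"
  proof (rule sum.cong[OF refl])
    fix i assume "i \<in> {..<N}"
    then have "(\<integral>\<^sup>+z\<in>cball (x i) r. indicator ?U z \<partial>lborel) = (\<integral>\<^sup>+z. indicator (cball (x i) r) z \<partial>lborel)"
      by (intro nn_integral_cong) (auto simp: indicator_def)
    then show "ennreal c * (\<integral>\<^sup>+z\<in>cball (x i) r. indicator ?U z \<partial>lborel) = ennreal c * ennreal A"
      by (simp add: emb)
  qed
  also have "\<dots> = ennreal (real N * (c * A))"
    using c A by (simp add: ennreal_mult ennreal_of_nat_eq_real_of_nat)
  also have "real N * (c * A) = 1" using A N by (simp add: c_def)
  finally have one: "emeasure \<rho> ?U = 1" by simp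
  have "riesz_energy \<alpha> ?U \<le> measure_energy \<alpha> \<rho>"
    by (intro riesz_energy_le one) (simp add: \<rho>_def)
  also have "measure_energy \<alpha> \<rho> = (\<integral>\<^sup>+y. (\<Sum>i<N. ennreal c * (\<integral>\<^sup>+z\<in>cball (x i) r. riesz_kernel \<alpha> z y \<partial>lborel)) \<partial>\<rho>)"
    unfolding measure_energy_def by (intro nn_integral_cong int\<rho>) measurable
  also have "\<dots> = (\<Sum>j<N. ennreal c *
      (\<integral>\<^sup>+y\<in>cball (x j) r. (\<Sum>i<N. ennreal c * (\<integral>\<^sup>+z\<in>cball (x i) r. riesz_kernel \<alpha> z y \<partial>lborel)) \<partial>lborel))"
    by (intro int\<rho>) measurable
  also have "\<dots> = (\<Sum>j<N. \<Sum>i<N. ennreal c * (ennreal c *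
      (\<integral>\<^sup>+y\<in>cball (x j) r. (\<integral>\<^sup>+z\<in>cball (x i) r. riesz_kernel \<alpha> z y \<partial>lborel) \<partial>lborel)))"
  proof (rule sum.cong[OF refl])
    fix j
    have "(\<integral>\<^sup>+y\<in>cball (x j) r. (\<Sum>i<N. ennreal c * (\<integral>\<^sup>+z\<in>cball (x i) r. riesz_kernel \<alpha> z y \<partial>lborel)) \<partial>lborel)
      = (\<integral>\<^sup>+y. (\<Sum>i<N. ennreal c * ((\<integral>\<^sup>+z\<in>cball (x i) r. riesz_kernel \<alpha> z y \<partial>lborel) * indicator (cball (x j) r) y)) \<partial>lborel)"
      by (intro nn_integral_cong, subst sum_distrib_right, rule sum.cong[OF refl], simp only: mult_ac)
    also have "\<dots> = (\<Sum>i<N. \<integral>\<^sup>+y. ennreal c * ((\<integral>\<^sup>+z\<in>cball (x i) r. riesz_kernel \<alpha> z y \<partial>lborel) * indicator (cball (x j) r) y) \<partial>lborel)"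
      by (intro nn_integral_sum) measurable
    also have "\<dots> = (\<Sum>i<N. ennreal c * (\<integral>\<^sup>+y\<in>cball (x j) r. (\<integral>\<^sup>+z\<in>cball (x i) r. riesz_kernel \<alpha> z y \<partial>lborel) \<partial>lborel))"
      by (intro sum.cong refl nn_integral_cmult) measurable
    finally show "ennreal c * (\<integral>\<^sup>+y\<in>cball (x j) r. (\<Sum>i<N. ennreal c * (\<integral>\<^sup>+z\<in>cball (x i) r. riesz_kernel \<alpha> z y \<partial>lborel)) \<partial>lborel)
      = (\<Sum>i<N. ennreal c * (ennreal c *
      (\<integral>\<^sup>+y\<in>cball (x j) r. (\<integral>\<^sup>+z\<in>cball (x i) r. riesz_kernel \<alpha> z y \<partial>lborel) \<partial>lborel)))"
      by (simp add: sum_distrib_left)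
  qed
  also have "\<dots> \<le> (\<Sum>j<N. \<Sum>i<N. ennreal (1 / (real N)\<^sup>2) * ball_kernel \<alpha> L C r (x j, x i))"
  proof (intro sum_mono)
    fix i j
    have "(\<integral>\<^sup>+y\<in>cball (x j) r. (\<integral>\<^sup>+z\<in>cball (x i) r. riesz_kernel \<alpha> z y \<partial>lborel) \<partial>lborel)
      \<le> ennreal (A * A) * ball_kernel \<alpha> L C r (x i, x j)"
      unfolding A_def by (rule ball_ball_energy_le[OF \<alpha> L r C0 C])
    then have "ennreal c * (ennreal c * (\<integral>\<^sup>+y\<in>cball (x j) r. (\<integral>\<^sup>+z\<in>cball (x i) r. riesz_kernel \<alpha> z y \<partial>lborel) \<partial>lborel))
      \<le> ennreal c * (ennreal c * (ennreal (A * A) * ball_kernel \<alpha> L C r (x i, x j)))"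
      by (intro mult_left_mono) auto
    also have "\<dots> = ennreal (c * c * (A * A)) * ball_kernel \<alpha> L C r (x i, x j)"
      using c A by (simp add: ennreal_mult mult_ac)
    also have "c * c * (A * A) = 1 / (real N)\<^sup>2"
      using A N by (simp add: c_def power2_eq_square field_simps)
    finally show "ennreal c * (ennreal c * (\<integral>\<^sup>+y\<in>cball (x j) r. (\<integral>\<^sup>+z\<in>cball (x i) r. riesz_kernel \<alpha> z y \<partial>lborel) \<partial>lborel))
      \<le> ennreal (1 / (real N)\<^sup>2) * ball_kernel \<alpha> L C r (x j, x i)"
      by (simp add: ball_kernel_commute[of _ _ _ _ "x j"])
  qed
  finally show ?thesis by (simp add: sum_distrib_left)
qed

text \<open>The error \<eta> is spent in quarters: on the almost optimal charge
  \<open>\<nu>\<close>, on the factor t^(-\<alpha>) for distant pairs, on the near-diagonal energy,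
  and on the self-energy of the balls. The choices are made in the order \<open>\<nu>\<close>,
  \<open>t\<close>, \<open>s\<close>, \<open>r\<close>.\<close>

lemma riesz_energy_ball_cloud:
  fixes E :: "'a::euclidean_space set" and \<alpha> :: real
  assumes E: "compact E" and \<alpha>: "0 < \<alpha>" "\<alpha> < real DIM('a) - 1"
    and fin: "riesz_energy \<alpha> E < \<infinity>" and \<eta>: "\<eta> > 0"
  obtains N :: nat and x :: "nat \<Rightarrow> 'a" and r where "0 < r" "r \<le> \<eta>" "real N * r ^ (DIM('a) - 1) \<le> \<eta>"
    "\<forall>i<N. x i \<in> E" "riesz_energy \<alpha> (\<Union>i<N. cball (x i) r) \<le> riesz_energy \<alpha> E + ennreal \<eta>"
proof -
  let ?w = "unit_ball_vol DIM('a)"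
  have w: "?w > 0" by simp
  have E': "E \<in> sets borel" using E by (simp add: borel_compact)
  have "\<alpha> < DIM('a)" using \<alpha> by simp
  then obtain C0 :: real where C0: "C0 > 0"
    "\<forall>r>0. \<forall>p q::'a. (\<integral>\<^sup>+w\<in>cball p r. riesz_kernel \<alpha> q w \<partial>lborel) \<le> ennreal (C0 * r powr (DIM('a) - \<alpha>))"
    by (rule nn_integral_riesz_kernel_cball_le[OF \<alpha>(1)])
  define C where "C = C0 / ?w"
  have C: "C > 0" using C0(1) w by (simp add: C_def)
  have Cw: "C0 = C * ?w" using less_imp_neq[OF w] by (simp add: C_def)
  note Cb = C0(2)[unfolded Cw]
  have "riesz_energy \<alpha> E < riesz_energy \<alpha> E + ennreal (\<eta> / 4)"
    using fin \<eta> by (simp add: ennreal_add_left_cancel_less[of _ 0, simplified] less_top)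
  then obtain \<nu> where \<nu>: "sets \<nu> = sets borel" "prob_space \<nu>" "emeasure \<nu> E = 1"
    "measure_energy \<alpha> \<nu> < riesz_energy \<alpha> E + ennreal (\<eta> / 4)"
    by (rule riesz_energy_lessE[OF _ E'])
  interpret prob_space \<nu> by (rule \<nu>(2))
  have [measurable_cong]: "sets \<nu> = sets borel" by fact
  have fin\<nu>: "measure_energy \<alpha> \<nu> < \<infinity>"
    using \<nu>(4) by (rule less_le_trans) simp
  then obtain e where e: "e \<ge> 0" "measure_energy \<alpha> \<nu> = ennreal e"
    by (cases "measure_energy \<alpha> \<nu>") auto
  \<comment> \<open>\<open>t\<close> is the fraction of their distance that distant pairs retain;
    close to 1 it raises the energy by less than \<eta>/4. \<open>L\<close> is then determined by 1
    - 2/L = t.\<close>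
  have "((\<lambda>t::real. t powr - \<alpha> * e) \<longlongrightarrow> 1 powr - \<alpha> * e) (at_left 1)"
    by (intro tendsto_intros) auto
  then have "\<forall>\<^sub>F t in at_left (1::real). t powr - \<alpha> * e < e + \<eta> / 4"
    using \<eta> by (intro order_tendstoD) auto
  then have "\<forall>\<^sub>F t in at_left (1::real). t powr - \<alpha> * e < e + \<eta> / 4 \<and> t \<in> {0<..<1}"
    using eventually_at_left_real[of 0 1] by (auto intro: eventually_conj)
  then obtain t where t: "t powr - \<alpha> * e < e + \<eta> / 4" "0 < t" "t < 1"
    using eventually_happens'[OF trivial_limit_at_left_real] by fastforce
  define L where "L = 2 / (1 - t)"
  have L: "L > 2" "1 - 2 / L = t" using t by (auto simp: L_def field_simps)
  \<comment> \<open>Chosen to cancel the factor C L^\<alpha> that \<open>ball_kernel_le\<close> puts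
    on the near-diagonal energy.\<close>
  define \<epsilon> where "\<epsilon> = \<eta> / 4 / (C * L powr \<alpha>)"
  have \<epsilon>: "\<epsilon> > 0" using \<eta> C L by (simp add: \<epsilon>_def)
  obtain s where s: "s > 0"
    "(\<integral>\<^sup>+z. \<integral>\<^sup>+y. riesz_kernel \<alpha> z y * indicator {p. dist (fst p) (snd p) < s} (z, y) \<partial>\<nu> \<partial>\<nu>) < ennreal \<epsilon>"
    by (rule energy_near_diagonal_small[OF \<nu>(2) \<nu>(1) fin\<nu>, of "ennreal \<epsilon>"]) (use \<epsilon> in auto)
  \<comment> \<open>The midpoint of the gap between \<alpha> and d-1. With N about r^(-\<beta>), the
    surface quantity N r^(d-1) behaves like r^(d-1-\<beta>) and the self-energy like
    r^(\<beta>-\<alpha>), both with positive exponent.\<close>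
  define \<beta> where "\<beta> = (\<alpha> + (real DIM('a) - 1)) / 2"
  have \<beta>: "\<alpha> < \<beta>" "\<beta> < real DIM('a) - 1" using \<alpha> by (auto simp: \<beta>_def)
  have pw: "((\<lambda>r::real. r powr a) \<longlongrightarrow> 0) (at_right 0)" if "a > 0" for a
    by (rule tendsto_zero_powrI[where b=a])
       (use that in \<open>auto intro!: tendsto_eq_intros simp: eventually_at_right_less eventually_at_topological eventually_at_filter\<close>)
  \<comment> \<open>The second summand pays for rounding \<open>r powr - \<beta>\<close> up to the
    integer \<open>N\<close>.\<close>
  have "((\<lambda>r::real. r powr (real DIM('a) - 1 - \<beta>) + r powr (real DIM('a) - 1)) \<longlongrightarrow> 0 + 0) (at_right 0)"
    using \<alpha> \<beta> by (intro tendsto_add pw) auto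
  then have ev1: "\<forall>\<^sub>F r in at_right (0::real). r powr (real DIM('a) - 1 - \<beta>) + r powr (real DIM('a) - 1) < \<eta>"
    using \<eta> by (intro order_tendstoD) auto
  have "((\<lambda>r::real. C * r powr (\<beta> - \<alpha>)) \<longlongrightarrow> C * 0) (at_right 0)"
    using \<beta> by (intro tendsto_mult tendsto_const pw) auto
  then have ev2: "\<forall>\<^sub>F r in at_right (0::real). C * r powr (\<beta> - \<alpha>) < \<eta> / 4"
    using \<eta> by (intro order_tendstoD) auto
  have "0 < min \<eta> (s / L)" using \<eta> s L by simp
  then have ev3: "\<forall>\<^sub>F r in at_right (0::real). r \<in> {0<..<min \<eta> (s / L)}"
    by (rule eventually_at_right_real)
  obtain r where r1: "r powr (real DIM('a) - 1 - \<beta>) + r powr (real DIM('a) - 1) < \<eta>"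
    and r2: "C * r powr (\<beta> - \<alpha>) < \<eta> / 4" and r3: "0 < r" "r < \<eta>" "r < s / L"
    using eventually_happens'[OF trivial_limit_at_right_real eventually_conj[OF ev1 eventually_conj[OF ev2 ev3]]]
    by auto
  have Lr: "L * r \<le> s" using r3(3) L by (simp add: field_simps)
  define N where "N = nat \<lceil>r powr - \<beta>\<rceil>"
  have rb: "r powr - \<beta> > 0" using r3 by simp
  have N: "real N \<ge> r powr - \<beta>" "real N \<le> r powr - \<beta> + 1"
  proof -
    have "real N = of_int \<lceil>r powr - \<beta>\<rceil>" using rb by (simp add: N_def)
    then show "real N \<ge> r powr - \<beta>" "real N \<le> r powr - \<beta> + 1"
      by (simp_all add: of_int_ceiling_le_add_one)
  qed
  have N0: "N > 0" using N(1) rb by (cases N) auto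
  have dimpw: "r ^ (DIM('a) - 1) = r powr (real DIM('a) - 1)"
    using r3(1) by (simp add: powr_realpow[symmetric] of_nat_diff Suc_leI)
  have "real N * r ^ (DIM('a) - 1) \<le> (r powr - \<beta> + 1) * r powr (real DIM('a) - 1)"
    unfolding dimpw by (intro mult_right_mono N) auto
  also have "\<dots> = r powr (real DIM('a) - 1 - \<beta>) + r powr (real DIM('a) - 1)"
    by (simp add: distrib_right powr_add[symmetric])
  finally have per: "real N * r ^ (DIM('a) - 1) \<le> \<eta>" using r1 by simp
  have "C * r powr - \<alpha> / real N \<le> C * r powr - \<alpha> / r powr - \<beta>"
    using N(1) rb C by (intro divide_left_mono) (auto simp: N0)
  also have "\<dots> = C * r powr (\<beta> - \<alpha>)" using r3 by (simp add: powr_diff powr_minus field_simps)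
  finally have self: "C * r powr - \<alpha> / real N \<le> \<eta> / 4"
    using r2 by (rule order_trans[OF _ less_imp_le])
  let ?H = "ball_kernel \<alpha> L C r :: 'a \<times> 'a \<Rightarrow> ennreal"
  let ?near = "\<lambda>z y. riesz_kernel \<alpha> z y * indicator {p. dist (fst p) (snd p) < s} (z, y)"
  have "(\<integral>\<^sup>+z. \<integral>\<^sup>+y. ?H (z, y) \<partial>\<nu> \<partial>\<nu>) \<le>
      (\<integral>\<^sup>+z. \<integral>\<^sup>+y. ennreal (t powr - \<alpha>) * riesz_kernel \<alpha> z y + ennreal (C * L powr \<alpha>) * ?near z y \<partial>\<nu> \<partial>\<nu>)"
    using ball_kernel_le[OF L(1) r3(1) C \<alpha>(1) Lr, unfolded L(2)] by (intro nn_integral_mono)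
  also have "\<dots> = ennreal (t powr - \<alpha>) * (\<integral>\<^sup>+z. \<integral>\<^sup>+y. riesz_kernel \<alpha> z y \<partial>\<nu> \<partial>\<nu>)
      + ennreal (C * L powr \<alpha>) * (\<integral>\<^sup>+z. \<integral>\<^sup>+y. ?near z y \<partial>\<nu> \<partial>\<nu>)"
    by (simp add: nn_integral_add nn_integral_cmult)
  also have "(\<integral>\<^sup>+z. \<integral>\<^sup>+y. riesz_kernel \<alpha> z y \<partial>\<nu> \<partial>\<nu>) = measure_energy \<alpha> \<nu>"
    unfolding measure_energy_def by (intro nn_integral_cong riesz_kernel_commute)
  also have "ennreal (t powr - \<alpha>) * measure_energy \<alpha> \<nu> + ennreal (C * L powr \<alpha>) * (\<integral>\<^sup>+z. \<integral>\<^sup>+y. ?near z y \<partial>\<nu> \<partial>\<nu>)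
      \<le> ennreal (t powr - \<alpha> * e) + ennreal (C * L powr \<alpha>) * ennreal \<epsilon>"
    using s(2) e by (intro add_mono mult_left_mono) (auto simp: ennreal_mult)
  also have "ennreal (C * L powr \<alpha>) * ennreal \<epsilon> = ennreal (\<eta> / 4)"
    using C L \<eta> by (simp add: \<epsilon>_def ennreal_mult[symmetric])
  also have "ennreal (t powr - \<alpha> * e) + ennreal (\<eta> / 4) \<le> ennreal (e + \<eta> / 2)"
    using t e \<eta> by (simp add: ennreal_plus[symmetric] ennreal_leI del: ennreal_plus)
  finally have eH: "(\<integral>\<^sup>+z. \<integral>\<^sup>+y. ?H (z, y) \<partial>\<nu> \<partial>\<nu>) \<le> ennreal (e + \<eta> / 2)" .
  have "\<exists>x. (\<forall>i<N. x i \<in> E) \<and> (\<Sum>i<N. \<Sum>j<i. ?H (x i, x j)) + (\<Sum>i<N. 0)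
    \<le> of_nat (\<Sum>i<N. i) * (\<integral>\<^sup>+z. \<integral>\<^sup>+y. ?H (z, y) \<partial>\<nu> \<partial>\<nu>) + of_nat N * integral\<^sup>N \<nu> (\<lambda>_. 0)"
    using E' \<nu>(1,3) by (intro exists_points_pair_sum_le) auto
  then obtain x where x: "\<forall>i<N. x i \<in> E"
    "(\<Sum>i<N. \<Sum>j<i. ?H (x i, x j)) \<le> of_nat (\<Sum>i<N. i) * (\<integral>\<^sup>+z. \<integral>\<^sup>+y. ?H (z, y) \<partial>\<nu> \<partial>\<nu>)"
    by auto
  \<comment> \<open>The number of unordered pairs. Symmetry of the kernel counts each twice, and
    \<open>2 * n2 \<le> (real N)\<^sup>2\<close>, so after division by N^2 the mean pair energy
    enters with a factor of at most 1.\<close>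
  define n2 where "n2 = real (\<Sum>i<N. i)"
  have n2: "n2 \<ge> 0" "2 * n2 \<le> (real N)\<^sup>2"
  proof -
    have "2 * (\<Sum>i<N. i) + N = N * N" for N :: nat by (induction N) auto
    from this[of N] have "2 * n2 + real N = real N * real N"
      unfolding n2_def by (metis of_nat_add of_nat_mult of_nat_numeral)
    then show "2 * n2 \<le> (real N)\<^sup>2" by (simp add: power2_eq_square)
    show "n2 \<ge> 0" unfolding n2_def by (rule of_nat_0_le_iff)
  qed
  have pairs: "(\<Sum>i<N. \<Sum>j<i. ?H (x i, x j)) \<le> ennreal (n2 * (e + \<eta> / 2))"
  proof -
    have "of_nat (\<Sum>i<N. i) * (\<integral>\<^sup>+z. \<integral>\<^sup>+y. ?H (z, y) \<partial>\<nu> \<partial>\<nu>) \<le> ennreal n2 * ennreal (e + \<eta> / 2)"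
      unfolding n2_def ennreal_of_nat_eq_real_of_nat using eH by (intro mult_left_mono) auto
    also have "\<dots> = ennreal (n2 * (e + \<eta> / 2))" using n2 e \<eta> by (simp add: ennreal_mult)
    finally show ?thesis using x(2) by order
  qed
  have "(\<Sum>i<N. \<Sum>j<N. ?H (x i, x j)) = (\<Sum>i<N. ?H (x i, x i)) + (\<Sum>i<N. \<Sum>j<i. ?H (x i, x j) + ?H (x j, x i))"
    by (rule sum_square_eq_diag_plus_pairs)
  also have "(\<Sum>i<N. \<Sum>j<i. ?H (x i, x j) + ?H (x j, x i)) =
      (\<Sum>i<N. \<Sum>j<i. ?H (x i, x j)) + (\<Sum>i<N. \<Sum>j<i. ?H (x i, x j))"
    by (simp add: sum.distrib ball_kernel_commute)
  also have "(\<Sum>i<N. ?H (x i, x i)) = ennreal (real N * (C * r powr - \<alpha>))"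
    using L r3 C by (simp add: ball_kernel_diag ennreal_mult ennreal_of_nat_eq_real_of_nat)
  also have "ennreal (real N * (C * r powr - \<alpha>)) + ((\<Sum>i<N. \<Sum>j<i. ?H (x i, x j)) + (\<Sum>i<N. \<Sum>j<i. ?H (x i, x j)))
      \<le> ennreal (real N * (C * r powr - \<alpha>)) + (ennreal (n2 * (e + \<eta> / 2)) + ennreal (n2 * (e + \<eta> / 2)))"
    by (intro add_mono pairs order_refl)
  also have "\<dots> = ennreal (real N * (C * r powr - \<alpha>) + 2 * n2 * (e + \<eta> / 2))"
    using C n2 e \<eta> by (simp add: ennreal_plus[symmetric] del: ennreal_plus)
  finally have sumH: "(\<Sum>i<N. \<Sum>j<N. ?H (x i, x j)) \<le> ennreal (real N * (C * r powr - \<alpha>) + 2 * n2 * (e + \<eta> / 2))" .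
  have "riesz_energy \<alpha> (\<Union>i<N. cball (x i) r) \<le> ennreal (1 / (real N)\<^sup>2) * (\<Sum>i<N. \<Sum>j<N. ?H (x i, x j))"
    by (rule riesz_energy_Union_cball_le[OF \<alpha>(1) L(1) r3(1) C Cb N0])
  also have "\<dots> \<le> ennreal (1 / (real N)\<^sup>2) * ennreal (real N * (C * r powr - \<alpha>) + 2 * n2 * (e + \<eta> / 2))"
    by (intro mult_left_mono sumH) auto
  also have "\<dots> = ennreal (1 / (real N)\<^sup>2 * (real N * (C * r powr - \<alpha>) + 2 * n2 * (e + \<eta> / 2)))"
    using C n2 e \<eta> by (intro ennreal_mult[symmetric]) auto
  also have "\<dots> \<le> ennreal (e + 3 * \<eta> / 4)"
  proof (rule ennreal_leI)
    have "1 / (real N)\<^sup>2 * (real N * (C * r powr - \<alpha>) + 2 * n2 * (e + \<eta> / 2))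
      = C * r powr - \<alpha> / real N + 2 * n2 / (real N)\<^sup>2 * (e + \<eta> / 2)"
      using N0 by (simp add: field_simps power2_eq_square)
    also have "\<dots> \<le> \<eta> / 4 + 1 * (e + \<eta> / 2)"
      using self n2 N0 e \<eta> by (intro add_mono mult_right_mono) (auto simp: divide_le_eq)
    finally show "1 / (real N)\<^sup>2 * (real N * (C * r powr - \<alpha>) + 2 * n2 * (e + \<eta> / 2)) \<le> e + 3 * \<eta> / 4"
      by simp
  qed
  also have "\<dots> = ennreal e + ennreal (3 * \<eta> / 4)" using e \<eta> by (simp add: ennreal_plus)
  also have "\<dots> \<le> (riesz_energy \<alpha> E + ennreal (\<eta> / 4)) + ennreal (3 * \<eta> / 4)"
    using \<nu>(4) e by (intro add_right_mono) auto
  also have "\<dots> = riesz_energy \<alpha> E + ennreal \<eta>"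
    using \<eta> by (simp add: add.assoc ennreal_plus[symmetric] del: ennreal_plus)
  finally show ?thesis using r3 per x(1) by (intro that[of r N x]) auto
qed

section \<open>Competitors\<close>

lemma hausdorff_distance_le:
  assumes "\<forall>x\<in>E. \<exists>y\<in>F. dist x y \<le> \<delta>" "\<forall>y\<in>F. \<exists>x\<in>E. dist x y \<le> \<delta>"
  shows "hausdorff_distance E F \<le> ennreal \<delta>"
  unfolding hausdorff_distance_def
proof (intro max.boundedI SUP_least)
  fix x assume "x \<in> E"
  then obtain y where "y \<in> F" "dist x y \<le> \<delta>" using assms(1) by blast
  then show "(INF y\<in>F. ennreal (dist x y)) \<le> ennreal \<delta>"
    by (intro INF_lower2[of y] ennreal_leI)
next
  fix y assume "y \<in> F"
  then obtain x where "x \<in> E" "dist x y \<le> \<delta>" using assms(2) by blast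
  then show "(INF x\<in>E. ennreal (dist x y)) \<le> ennreal \<delta>"
    by (intro INF_lower2[of x] ennreal_leI)
qed

lemma compact_infdist_neighbourhood:
  fixes E :: "'a::euclidean_space set"
  assumes "compact E" "E \<noteq> {}"
  shows "compact {x. infdist x E \<le> \<delta>}"
proof (cases "\<delta> > 0")
  case False
  have "{x. infdist x E \<le> \<delta>} = (if \<delta> = 0 then E else {})"
    using False assms in_closed_iff_infdist_zero[OF compact_imp_closed[OF assms(1)] assms(2)]
    by (auto simp: not_less infdist_nonneg dest: order_antisym[OF _ infdist_nonneg] order_trans[OF infdist_nonneg])
  then show ?thesis using assms(1) by simp
qed (use compact_infdist_le[OF assms(2,1)] in simp)

text \<open>Closed neighbourhoods of a compact set have finite measure and decrease to the set
  itself, so continuity from above applies.\<close>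

lemma content_neighbourhood_close:
  fixes E :: "'a::euclidean_space set"
  assumes E: "compact E" "E \<noteq> {}" and \<epsilon>: "\<epsilon> > 0"
  obtains \<delta> where "\<delta> > 0" "measure lborel {x. infdist x E \<le> \<delta>} \<le> measure lborel E + \<epsilon>"
proof -
  let ?S = "\<lambda>n. {x. infdist x E \<le> 1 / real (Suc n)}"
  have "(\<lambda>n. measure lborel (?S n)) \<longlonglongrightarrow> measure lborel (\<Inter>n. ?S n)"
  proof (rule Lim_measure_decseq)
    show "range ?S \<subseteq> sets lborel"
      using compact_infdist_neighbourhood[OF E] by (auto intro: borel_compact)
    show "emeasure lborel (?S i) \<noteq> \<infinity>" for i
      using emeasure_compact_finite[OF compact_infdist_neighbourhood[OF E]] by (metis less_irrefl infinity_ennreal_def)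
    show "decseq ?S"
    proof (rule decseq_SucI)
      fix n
      have "1 / real (Suc (Suc n)) \<le> 1 / real (Suc n)" by (intro divide_left_mono) auto
      then show "?S (Suc n) \<le> ?S n" by auto
    qed
  qed
  also have "(\<Inter>n. ?S n) = E"
  proof (intro set_eqI iffI)
    fix x assume x: "x \<in> (\<Inter>n. ?S n)"
    have "infdist x E \<le> 0"
    proof (rule field_le_epsilon)
      fix e :: real assume "e > 0"
      then obtain n where "1 / real (Suc n) < e" using nat_approx_posE by blast
      moreover have "infdist x E \<le> 1 / real (Suc n)" using x by blast
      ultimately show "infdist x E \<le> 0 + e" by simp
    qed
    then have "infdist x E = 0" using infdist_nonneg[of x E] by linarith
    then show "x \<in> E" using in_closed_iff_infdist_zero[OF compact_imp_closed[OF E(1)] E(2)] by simp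
  qed (simp add: infdist_zero)
  finally have "\<forall>\<^sub>F n in sequentially. measure lborel (?S n) < measure lborel E + \<epsilon>"
    using \<epsilon> by (intro order_tendstoD) auto
  then obtain n where "measure lborel (?S n) < measure lborel E + \<epsilon>" by (auto simp: eventually_sequentially)
  then show ?thesis by (intro that[of "1 / real (Suc n)"]) auto
qed

text \<open>Containment of \<open>F\<close> in a thin neighbourhood of \<open>E\<close> makes
  \<open>F - E\<close> small; equality of volumes transfers the bound to
  \<open>E - F\<close>.\<close>

lemma content_sym_diff_small:
  fixes E :: "'a::euclidean_space set"
  assumes E: "compact E" "E \<noteq> {}" and \<epsilon>: "\<epsilon> > 0"
  obtains \<delta> where "\<delta> > 0"
    "\<forall>F. compact F \<and> measure lborel F = measure lborel E \<and> (\<forall>y\<in>F. \<exists>x\<in>E. dist x y \<le> \<delta>) \<longrightarrow>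
      measure lborel ((E - F) \<union> (F - E)) \<le> \<epsilon>"
proof -
  have "\<epsilon> / 2 > 0" using \<epsilon> by simp
  then obtain \<delta> where \<delta>: "\<delta> > 0" "measure lborel {x. infdist x E \<le> \<delta>} \<le> measure lborel E + \<epsilon> / 2"
    by (rule content_neighbourhood_close[OF E])
  let ?S = "{x. infdist x E \<le> \<delta>}"
  have S: "?S \<in> sets lborel" "emeasure lborel ?S < \<infinity>"
    using compact_infdist_neighbourhood[OF E] emeasure_compact_finite by (auto intro: borel_compact)
  have ES: "E \<subseteq> ?S" using \<delta>(1) by (auto simp: infdist_zero)
  have EM: "E \<in> sets lborel" "emeasure lborel E < \<infinity>"
    using E(1) emeasure_compact_finite by (auto intro: borel_compact)
  have "measure lborel ((E - F) \<union> (F - E)) \<le> \<epsilon>"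
    if F: "compact F" and eq: "measure lborel F = measure lborel E"
      and near: "\<forall>y\<in>F. \<exists>x\<in>E. dist x y \<le> \<delta>" for F
  proof -
    have FM: "F \<in> sets lborel" "emeasure lborel F < \<infinity>"
      using F emeasure_compact_finite by (auto intro: borel_compact)
    have FS: "F \<subseteq> ?S"
      using near by (auto intro: infdist_le2 simp: dist_commute)
    have D: "measure lborel (A - B) = measure lborel A - measure lborel (A \<inter> B)"
      if "A \<in> sets lborel" "emeasure lborel A < \<infinity>" "B \<in> sets lborel" for A B :: "'a set"
    proof -
      have "A - B = A - A \<inter> B" by blast
      then show ?thesis using that by (simp only:, intro measure_Diff) auto
    qed
    have "measure lborel (F - E) \<le> measure lborel (?S - E)"
      using FS FM EM S
      by (intro measure_mono_fmeasurable fmeasurable_Diff fmeasurable_compact compact_infdist_neighbourhood[OF E]) auto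
    also have "\<dots> \<le> \<epsilon> / 2" using D[OF S EM(1)] \<delta>(2) ES by (simp add: Int_absorb1)
    finally have 1: "measure lborel (F - E) \<le> \<epsilon> / 2" .
    have "measure lborel (E - F) = measure lborel (F - E)"
      using D[OF EM FM(1)] D[OF FM EM(1)] eq by (simp add: Int_commute)
    with 1 measure_Un_le[of "E - F" lborel "F - E"] EM FM show ?thesis by auto
  qed
  then show ?thesis using \<delta>(1) by (intro that[of \<delta>]) auto
qed

lemma local_minimizer_le:
  fixes E :: "'a::euclidean_space set"
  assumes E: "compact E" "E \<noteq> {}"
    and min: "L1_local_minimizer \<alpha> Q E \<or> Hausdorff_local_minimizer \<alpha> Q E"
  obtains \<delta> where "\<delta> > 0"
    "\<forall>F. compact F \<and> measure lborel F = measure lborel E \<and>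
      (\<forall>x\<in>E. \<exists>y\<in>F. dist x y \<le> \<delta>) \<and> (\<forall>y\<in>F. \<exists>x\<in>E. dist x y \<le> \<delta>) \<longrightarrow>
      charged_energy \<alpha> Q E \<le> charged_energy \<alpha> Q F"
proof -
  \<comment> \<open>The definitions measure by \<open>lebesgue\<close>; the sets met here are
    compact or differences of compact sets, hence Borel, where \<open>lborel\<close> agrees.\<close>
  have leb: "measure lebesgue X = measure lborel X" if "X \<in> sets borel" for X :: "'a set"
    using that by simp
  have bor: "X \<in> sets borel" if "compact X" for X :: "'a set" using that by (rule borel_compact)
  from min show ?thesis
  proof
    assume "L1_local_minimizer \<alpha> Q E"
    then obtain \<epsilon> where \<epsilon>: "\<epsilon> > 0" "\<forall>F. compact F \<and> measure lebesgue F = measure lebesgue E \<and>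
        measure lebesgue ((E - F) \<union> (F - E)) \<le> \<epsilon> \<longrightarrow> charged_energy \<alpha> Q E \<le> charged_energy \<alpha> Q F"
      unfolding L1_local_minimizer_def by (elim conjE exE)
    obtain \<delta> where \<delta>: "\<delta> > 0"
      "\<forall>F. compact F \<and> measure lborel F = measure lborel E \<and> (\<forall>y\<in>F. \<exists>x\<in>E. dist x y \<le> \<delta>) \<longrightarrow>
        measure lborel ((E - F) \<union> (F - E)) \<le> \<epsilon>"
      by (rule content_sym_diff_small[OF E \<epsilon>(1)])
    show ?thesis
    proof (rule that[OF \<delta>(1)], intro allI impI)
      fix F assume F: "compact F \<and> measure lborel F = measure lborel E \<and>
        (\<forall>x\<in>E. \<exists>y\<in>F. dist x y \<le> \<delta>) \<and> (\<forall>y\<in>F. \<exists>x\<in>E. dist x y \<le> \<delta>)"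
      then have "measure lborel ((E - F) \<union> (F - E)) \<le> \<epsilon>" using \<delta>(2) by blast
      moreover have "(E - F) \<union> (F - E) \<in> sets borel" using F E(1) by (intro sets.Un sets.Diff bor) auto
      ultimately show "charged_energy \<alpha> Q E \<le> charged_energy \<alpha> Q F"
        using \<epsilon>(2) F E bor leb by metis
    qed
  next
    assume "Hausdorff_local_minimizer \<alpha> Q E"
    then obtain \<epsilon> where \<epsilon>: "\<epsilon> > 0" "\<forall>F. compact F \<and> measure lebesgue F = measure lebesgue E \<and>
        hausdorff_distance E F \<le> ennreal \<epsilon> \<longrightarrow> charged_energy \<alpha> Q E \<le> charged_energy \<alpha> Q F"
      unfolding Hausdorff_local_minimizer_def by (elim conjE exE)
    show ?thesis
    proof (rule that[OF \<epsilon>(1)], intro allI impI)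
      fix F assume F: "compact F \<and> measure lborel F = measure lborel E \<and>
        (\<forall>x\<in>E. \<exists>y\<in>F. dist x y \<le> \<epsilon>) \<and> (\<forall>y\<in>F. \<exists>x\<in>E. dist x y \<le> \<epsilon>)"
      then have "hausdorff_distance E F \<le> ennreal \<epsilon>" by (intro hausdorff_distance_le) auto
      then show "charged_energy \<alpha> Q E \<le> charged_energy \<alpha> Q F"
        using \<epsilon>(2) F E bor leb by metis
    qed
  qed
qed

text \<open>The ratio is the d-th root of |E|/|G|. Monotonicity of volume gives l \<le> 1, and the
  allowed excess of volume gives l \<ge> 1/\<sigma>.\<close>

lemma rescale_to_content:
  fixes E G :: "'a::euclidean_space set"
  assumes E: "compact E" "measure lborel E > 0" and G: "compact G" "E \<subseteq> G"
    and \<sigma>: "\<sigma> > 1" "measure lborel G \<le> \<sigma> ^ DIM('a) * measure lborel E"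
  obtains l where "1 / \<sigma> \<le> l" "0 < l" "l \<le> 1" "compact ((\<lambda>x. l *\<^sub>R x) ` G)"
    "measure lborel ((\<lambda>x. l *\<^sub>R x) ` G) = measure lborel E"
proof -
  let ?e = "measure lborel E" and ?g = "measure lborel G"
  have eg: "?e \<le> ?g"
    using E G by (intro measure_mono_fmeasurable fmeasurable_compact) (auto intro: borel_compact)
  define l where "l = root DIM('a) (?e / ?g)"
  have ld: "l ^ DIM('a) = ?e / ?g" using E eg by (simp add: l_def)
  have l0: "l > 0" using E eg by (simp add: l_def)
  have l1: "l \<le> 1" using E eg by (simp add: l_def divide_le_eq)
  have "(1 / \<sigma>) ^ DIM('a) \<le> l ^ DIM('a)"
    using \<sigma> E eg unfolding ld by (simp add: power_divide field_simps)
  then have ls: "1 / \<sigma> \<le> l"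
    by (rule power_mono_iff[THEN iffD1, rotated -1]) (use \<sigma> l0 in auto)
  have "measure lborel ((\<lambda>x. l *\<^sub>R x) ` G) = ?e"
    using content_dilation[OF G(1) l0] ld E eg by simp
  moreover have "compact ((\<lambda>x. l *\<^sub>R x) ` G)"
    by (intro compact_continuous_image continuous_intros G)
  ultimately show ?thesis using that ls l0 l1 by blast
qed

text \<open>The square anticipates the dilation of the cloud by \<sigma>^2: with this choice no
  point within \<open>R\<close> of the origin moves by more than \<delta>.\<close>

lemma scale_factor_close_to_1:
  fixes \<delta> R :: real
  assumes "\<delta> > 0" "R > 0"
  obtains \<sigma> where "\<sigma> > 1" "(\<sigma>\<^sup>2 - 1) * R \<le> \<delta>"
proof
  show "sqrt (1 + \<delta> / R) > 1" using assms by simp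
  have "(sqrt (1 + \<delta> / R))\<^sup>2 = 1 + \<delta> / R" using assms by (intro real_sqrt_pow2) (simp add: add_nonneg_nonneg)
  then show "((sqrt (1 + \<delta> / R))\<^sup>2 - 1) * R \<le> \<delta>" using assms by simp
qed

text \<open>Serves contractions and enlargements alike; the contraction side holds since 1 -
  1/\<sigma> \<le> \<sigma> - 1 \<le> \<sigma>^2 - 1.\<close>

lemma dist_scaleR_le:
  fixes x :: "'a::real_normed_vector"
  assumes "1 / \<sigma> \<le> l" "l \<le> \<sigma>\<^sup>2" "\<sigma> > 1"
  shows "dist x (l *\<^sub>R x) \<le> (\<sigma>\<^sup>2 - 1) * norm x"
proof -
  have "x - l *\<^sub>R x = (1 - l) *\<^sub>R x" by (simp add: scaleR_diff_left)
  then have "dist x (l *\<^sub>R x) = \<bar>1 - l\<bar> * norm x" by (simp add: dist_norm)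
  also have "\<bar>1 - l\<bar> \<le> \<sigma>\<^sup>2 - 1"
  proof -
    have "1 - l \<le> 1 - 1 / \<sigma>" using assms by simp
    also have "\<dots> = (\<sigma> - 1) / \<sigma>" using assms by (simp add: field_simps)
    also have "\<dots> \<le> \<sigma> - 1" using assms by (simp add: divide_le_eq)
    also have "\<dots> \<le> \<sigma>\<^sup>2 - 1" using assms by (simp add: power2_eq_square)
    finally show ?thesis using assms(2) by simp
  qed
  finally show ?thesis by (simp add: mult_right_mono)
qed

lemma finite_energy_competitor:
  fixes E :: "'a::euclidean_space set" and \<alpha> :: real
  assumes E: "compact E" "measure lborel E > 0" and \<alpha>: "0 < \<alpha>" "\<alpha> < DIM('a)" and \<delta>: "\<delta> > 0"
  obtains F where "compact F" "measure lborel F = measure lborel E"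
    "\<forall>x\<in>E. \<exists>y\<in>F. dist x y \<le> \<delta>" "\<forall>y\<in>F. \<exists>x\<in>E. dist x y \<le> \<delta>" "charged_energy \<alpha> Q F < \<infinity>"
proof -
  have ne: "E \<noteq> {}" using E(2) by auto
  obtain R0 where R0: "R0 > 0" "\<forall>x\<in>E. norm x \<le> R0"
    using compact_imp_bounded[OF E(1)] unfolding bounded_pos by auto
  define R where "R = R0 + \<delta>"
  have R: "R > 0" using R0 \<delta> by (simp add: R_def)
  have "\<delta> / 2 > 0" using \<delta> by simp
  then obtain \<sigma> where \<sigma>: "\<sigma> > 1" "(\<sigma>\<^sup>2 - 1) * R \<le> \<delta> / 2" by (rule scale_factor_close_to_1[OF _ R])
  \<comment> \<open>The volume by which the covering may exceed \<open>E\<close> so that shrinking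
    by 1/\<sigma> at most suffices to restore |E|.\<close>
  have "(\<sigma> ^ DIM('a) - 1) * measure lborel E > 0" using \<sigma>(1) E(2) by simp
  then obtain \<rho>0 where \<rho>0: "\<rho>0 > 0"
    "measure lborel {x. infdist x E \<le> \<rho>0} \<le> measure lborel E + (\<sigma> ^ DIM('a) - 1) * measure lborel E"
    by (rule content_neighbourhood_close[OF E(1) ne])
  define \<rho> where "\<rho> = min \<rho>0 (\<delta> / 2)"
  have \<rho>: "\<rho> > 0" "\<rho> \<le> \<rho>0" "\<rho> \<le> \<delta> / 2" using \<rho>0 \<delta> by (auto simp: \<rho>_def)
  obtain C where C: "C \<subseteq> E" "finite C" "E \<subseteq> (\<Union>c\<in>C. ball c \<rho>)"
    by (rule compactE_image[OF E(1), of E "\<lambda>c. ball c \<rho>"]) (use \<rho>(1) in auto)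
  obtain N :: nat and c where c: "C = c ` {i. i < N}"
    using finite_imp_nat_seg_image_inj_on[OF C(2)] by blast
  define G where "G = (\<Union>i<N. cball (c i) \<rho>)"
  have cE: "c i \<in> E" if "i < N" for i using that C(1) c by auto
  have Gc: "compact G" unfolding G_def by (intro compact_UN) auto
  have EG: "E \<subseteq> G"
    using C(3) unfolding G_def c by (auto simp: subset_eq) (meson less_imp_le lessThan_iff)
  have nearG: "\<exists>x\<in>E. dist x z \<le> \<rho>" if "z \<in> G" for z
    using that cE by (auto simp: G_def)
  have normG: "norm z \<le> R" if z: "z \<in> G" for z
  proof -
    obtain x where "x \<in> E" "dist x z \<le> \<rho>" using nearG[OF z] by blast
    then have "norm x \<le> R0" "norm (z - x) \<le> \<delta>" using R0 \<rho> \<delta> by (auto simp: dist_norm norm_minus_commute)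
    then show ?thesis using norm_triangle_sub[of z x] by (simp add: R_def)
  qed
  have "measure lborel G \<le> measure lborel {x. infdist x E \<le> \<rho>0}"
  proof (rule measure_mono_fmeasurable)
    show "G \<subseteq> {x. infdist x E \<le> \<rho>0}"
    proof
      fix z assume "z \<in> G"
      then obtain x where "x \<in> E" "dist x z \<le> \<rho>" using nearG by blast
      then show "z \<in> {x. infdist x E \<le> \<rho>0}" using \<rho>(2) by (auto intro: infdist_le2 simp: dist_commute)
    qed
    show "G \<in> sets lborel" using Gc by (auto intro: borel_compact)
    show "{x. infdist x E \<le> \<rho>0} \<in> fmeasurable lborel"
      by (intro fmeasurable_compact compact_infdist_neighbourhood[OF E(1) ne])
  qed
  also have "\<dots> \<le> \<sigma> ^ DIM('a) * measure lborel E" using \<rho>0(2) by (simp add: algebra_simps)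
  finally obtain l where l: "1 / \<sigma> \<le> l" "0 < l" "l \<le> 1" "compact ((\<lambda>x. l *\<^sub>R x) ` G)"
    "measure lborel ((\<lambda>x. l *\<^sub>R x) ` G) = measure lborel E"
    by (rule rescale_to_content[OF E Gc EG \<sigma>(1)])
  have l2: "l \<le> \<sigma>\<^sup>2" using l(3) \<sigma>(1) by (meson less_imp_le one_le_power order_trans)
  let ?F = "(\<lambda>x. l *\<^sub>R x) ` G"
  have move: "dist z (l *\<^sub>R z) \<le> \<delta> / 2" if "z \<in> G" for z
  proof -
    have "dist z (l *\<^sub>R z) \<le> (\<sigma>\<^sup>2 - 1) * norm z" by (rule dist_scaleR_le[OF l(1) l2 \<sigma>(1)])
    also have "\<dots> \<le> (\<sigma>\<^sup>2 - 1) * R" using normG[OF that] \<sigma>(1) by (intro mult_left_mono) auto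
    finally show ?thesis using \<sigma>(2) by simp
  qed
  have 1: "\<forall>x\<in>E. \<exists>y\<in>?F. dist x y \<le> \<delta>"
  proof
    fix x assume "x \<in> E"
    then have "x \<in> G" using EG by auto
    then show "\<exists>y\<in>?F. dist x y \<le> \<delta>" using move[of x] \<delta> by (intro bexI[of _ "l *\<^sub>R x"]) auto
  qed
  have 2: "\<forall>y\<in>?F. \<exists>x\<in>E. dist x y \<le> \<delta>"
  proof
    fix y assume "y \<in> ?F"
    then obtain z where z: "z \<in> G" "y = l *\<^sub>R z" by blast
    obtain x where x: "x \<in> E" "dist x z \<le> \<rho>" using nearG[OF z(1)] by blast
    have "dist x y \<le> dist x z + dist z y" by (rule dist_triangle)
    also have "\<dots> \<le> \<delta> / 2 + \<delta> / 2" using x(2) \<rho>(3) move[OF z(1)] z(2) by (intro add_mono) auto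
    finally show "\<exists>x\<in>E. dist x y \<le> \<delta>" using x(1) by auto
  qed
  have "perimeter ?F \<le> perimeter G" by (rule perimeter_dilation_le[OF Gc l(2,3)])
  also have "\<dots> < \<infinity>"
  proof -
    \<comment> \<open>The balls are added one by one to the empty set, of perimeter 0.\<close>
    have "perimeter ({} \<union> (\<Union>i<N. cball (c i) \<rho>)) < \<infinity>"
      by (rule le_less_trans[OF perimeter_Un_cballs_le]) (use \<rho>(1) in \<open>auto simp: perimeter_empty\<close>)
    then show ?thesis by (simp add: G_def)
  qed
  finally have P: "perimeter ?F < \<infinity>" .
  have "riesz_energy \<alpha> ?F < \<infinity>" using l(4,5) E(2) by (intro riesz_energy_finite \<alpha>) auto
  then have "charged_energy \<alpha> Q ?F < \<infinity>"
    using P by (simp add: charged_energy_def ennreal_mult_less_top)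
  then show ?thesis using that l(4,5) 1 2 by blast
qed

text \<open>With finite perimeter P and energy I the comparison is between the numbers P + K \<eta>
  + Q^2 q (I + 2 \<eta>) and P + Q^2 I. Every constant except \<eta> is fixed beforehand, so a small
  \<eta> decides it because q < 1.\<close>

lemma strictly_better_competitor:
  fixes E :: "'a::euclidean_space set" and \<alpha> :: real
  assumes E: "compact E" "measure lborel E > 0" and \<alpha>: "0 < \<alpha>" "\<alpha> < real DIM('a) - 1"
    and Q: "Q > 0" and \<delta>: "\<delta> > 0" and fin: "perimeter E < \<infinity>"
  obtains F where "compact F" "measure lborel F = measure lborel E"
    "\<forall>x\<in>E. \<exists>y\<in>F. dist x y \<le> \<delta>" "\<forall>y\<in>F. \<exists>x\<in>E. dist x y \<le> \<delta>"
    "charged_energy \<alpha> Q F < charged_energy \<alpha> Q E"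
proof -
  let ?d = "DIM('a)"
  let ?w = "unit_ball_vol ?d"
  have w: "?w > 0" by simp
  have EB: "E \<in> sets borel" using E(1) by (rule borel_compact)
  have finI: "riesz_energy \<alpha> E < \<infinity>" using \<alpha> by (intro riesz_energy_finite E) auto
  have posI: "riesz_energy \<alpha> E > 0" by (rule riesz_energy_pos[OF E(1) \<alpha>(1)])
  obtain I where I: "I > 0" "riesz_energy \<alpha> E = ennreal I"
    using finI posI by (cases "riesz_energy \<alpha> E") auto
  obtain P where P: "P \<ge> 0" "perimeter E = ennreal P"
    using fin by (cases "perimeter E") auto
  obtain R0 where R0: "R0 > 0" "\<forall>x\<in>E. norm x \<le> R0"
    using compact_imp_bounded[OF E(1)] unfolding bounded_pos by auto
  have "\<delta> / 2 > 0" "R0 + 1 > 0" using \<delta> R0 by auto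
  then obtain \<sigma> where \<sigma>: "\<sigma> > 1" "(\<sigma>\<^sup>2 - 1) * (R0 + 1) \<le> \<delta> / 2" by (rule scale_factor_close_to_1)
  \<comment> \<open>One factor \<sigma> is reserved for the later shrinking by
    \<open>l \<ge> 1 / \<sigma>\<close>; the net dilation \<open>l * \<tau>\<close> of the cloud is
    still at least \<sigma>.\<close>
  define \<tau> where "\<tau> = \<sigma>\<^sup>2"
  have \<tau>: "\<tau> > 1" using \<sigma>(1) by (simp add: \<tau>_def)
  define q where "q = \<sigma> powr - \<alpha>"
  have q: "0 < q" "q < 1" using \<sigma>(1) \<alpha>(1) by (auto simp: q_def powr_less_one)
  define K where "K = 5 * ?w * ?d * (2 * \<tau>) ^ (?d - 1)"
  have K: "K > 0" using \<tau> w by (simp add: K_def)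
  define V where "V = ?w * \<tau> ^ ?d"
  have V: "V > 0" using \<tau> w by (simp add: V_def)
  \<comment> \<open>The total coefficient of \<eta> among the costs: \<open>K\<close> from the
    perimeter of the dilated balls, the rest from the energy error of the cloud. It competes with
    \<open>gap\<close>, the energy saved by the factor \<open>q\<close>.\<close>
  define M where "M = K + 2 * Q\<^sup>2 * q"
  have M: "M > 0" unfolding M_def using K q by (intro add_pos_nonneg) auto
  define gap where "gap = Q\<^sup>2 * (1 - q) * I"
  have gap: "gap > 0" using Q q I by (simp add: gap_def)
  define vol where "vol = (\<sigma> ^ ?d - 1) * measure lborel E"
  have vol: "vol > 0" using \<sigma>(1) E(2) by (simp add: vol_def)
  \<comment> \<open>The bound 1 keeps the undilated balls within \<open>R0 + 1\<close> of the
    origin, \<delta>/2 keeps them close to \<open>E\<close>, \<open>vol / V\<close> limits the added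
    volume, and \<open>gap / (2 * M)\<close> holds the costs to half the gain.\<close>
  define \<eta> where "\<eta> = min (min 1 (\<delta> / 2)) (min (vol / V) (gap / (2 * M)))"
  have \<eta>: "\<eta> > 0" "\<eta> \<le> 1" "\<eta> \<le> \<delta> / 2" using \<delta> vol V gap M unfolding \<eta>_def by (simp, linarith+)
  have \<eta>V: "V * \<eta> \<le> vol"
  proof -
    have "\<eta> \<le> vol / V" by (simp add: \<eta>_def)
    then show ?thesis using V by (simp add: field_simps)
  qed
  have \<eta>M: "M * \<eta> < gap"
  proof -
    have "\<eta> \<le> gap / (2 * M)" by (simp add: \<eta>_def)
    then have "2 * (M * \<eta>) \<le> gap" using M by (simp add: field_simps)
    moreover have "M * \<eta> > 0" using M \<eta> by simp
    ultimately show ?thesis by linarith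
  qed
  obtain N :: nat and x :: "nat \<Rightarrow> 'a" and r where r: "0 < r" "r \<le> \<eta>" "real N * r ^ (?d - 1) \<le> \<eta>"
    and xE: "\<forall>i<N. x i \<in> E" and IB: "riesz_energy \<alpha> (\<Union>i<N. cball (x i) r) \<le> riesz_energy \<alpha> E + ennreal \<eta>"
    by (rule riesz_energy_ball_cloud[OF E(1) \<alpha> finI \<eta>(1)])
  define B where "B = (\<Union>i<N. cball (x i) r)"
  let ?B = "(\<lambda>x. \<tau> *\<^sub>R x) ` B"
  \<comment> \<open>The dilated cloud is again a union of balls, so the perimeter estimate for
    adding balls applies to it.\<close>
  have B\<tau>: "?B = (\<Union>i<N. cball (\<tau> *\<^sub>R x i) (\<tau> * r))"
    using \<tau> by (simp add: B_def image_UN cball_scale)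
  have Bc: "compact B" unfolding B_def by (intro compact_UN) auto
  have Bc': "compact ?B" by (intro compact_continuous_image continuous_intros Bc)
  define G where "G = E \<union> ?B"
  have Gc: "compact G" unfolding G_def using E(1) Bc' by (rule compact_Un)
  \<comment> \<open>The volume of the cloud is of order r times N r^(d-1), so the surface bound
    controls it as well.\<close>
  have rd: "r ^ ?d = r * r ^ (?d - 1)" by (cases "?d") auto
  have "measure lborel B \<le> (\<Sum>i<N. measure lborel (cball (x i) r))"
    unfolding B_def by (intro measure_UNION_le) auto
  also have "\<dots> = ?w * (r * (real N * r ^ (?d - 1)))"
    using r(1) by (simp add: content_cball rd)
  also have "\<dots> \<le> ?w * (1 * \<eta>)"
    using r \<eta> by (intro mult_left_mono mult_mono) auto
  finally have "\<tau> ^ ?d * measure lborel B \<le> \<tau> ^ ?d * (?w * (1 * \<eta>))"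
    using \<tau> by (intro mult_left_mono) auto
  moreover have "measure lborel ?B = \<tau> ^ ?d * measure lborel B" using Bc \<tau> by (intro content_dilation) auto
  ultimately have "measure lborel ?B \<le> V * \<eta>" by (simp add: V_def mult_ac)
  then have "measure lborel G \<le> measure lborel E + vol"
    using measure_Un_le[of E lborel ?B] EB Bc' \<eta>V by (auto simp: G_def borel_compact)
  then have "measure lborel G \<le> \<sigma> ^ ?d * measure lborel E" by (simp add: vol_def algebra_simps)
  then obtain l where l: "1 / \<sigma> \<le> l" "0 < l" "l \<le> 1" "compact ((\<lambda>x. l *\<^sub>R x) ` G)"
    "measure lborel ((\<lambda>x. l *\<^sub>R x) ` G) = measure lborel E"
    by (rule rescale_to_content[OF E Gc _ \<sigma>(1), rotated]) (auto simp: G_def)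
  let ?F = "(\<lambda>x. l *\<^sub>R x) ` G"
  have move: "dist z (t *\<^sub>R z) \<le> \<delta> / 2" if "norm z \<le> R0 + 1" "1 / \<sigma> \<le> t" "t \<le> \<sigma>\<^sup>2" for z :: 'a and t
  proof -
    have "dist z (t *\<^sub>R z) \<le> (\<sigma>\<^sup>2 - 1) * norm z" using that by (intro dist_scaleR_le \<sigma>(1))
    also have "\<dots> \<le> (\<sigma>\<^sup>2 - 1) * (R0 + 1)" using that(1) \<sigma>(1) by (intro mult_left_mono) auto
    finally show ?thesis using \<sigma>(2) by simp
  qed
  have ls2: "l \<le> \<sigma>\<^sup>2" using l(3) \<tau> unfolding \<tau>_def by linarith
  have l\<tau>: "\<sigma> \<le> l * \<tau>" "l * \<tau> \<le> \<sigma>\<^sup>2"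
  proof -
    have "1 \<le> l * \<sigma>" using l(1) \<sigma>(1) by (simp add: divide_le_eq)
    then have "\<sigma> * 1 \<le> \<sigma> * (l * \<sigma>)" using \<sigma>(1) by (intro mult_left_mono) auto
    then show "\<sigma> \<le> l * \<tau>" by (simp add: \<tau>_def power2_eq_square mult_ac)
    show "l * \<tau> \<le> \<sigma>\<^sup>2" using l(2,3) by (simp add: \<tau>_def mult_left_le_one_le)
  qed
  have l\<tau>': "1 / \<sigma> \<le> l * \<tau>"
  proof -
    have "1 / \<sigma> \<le> 1" using \<sigma>(1) by simp
    then show ?thesis using l\<tau>(1) \<sigma>(1) by linarith
  qed
  have E1: "\<exists>y\<in>?F. dist z y \<le> \<delta>" "\<exists>x\<in>E. dist x (l *\<^sub>R z) \<le> \<delta>" if z: "z \<in> E" for z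
  proof -
    have "norm z \<le> R0 + 1" using R0(2) z by force
    then have "dist z (l *\<^sub>R z) \<le> \<delta>" using move[OF _ l(1) ls2, of z] \<delta> by simp
    then show "\<exists>y\<in>?F. dist z y \<le> \<delta>" "\<exists>x\<in>E. dist x (l *\<^sub>R z) \<le> \<delta>"
      using z by (auto simp: G_def)
  qed
  have 2: "\<forall>y\<in>?F. \<exists>x\<in>E. dist x y \<le> \<delta>"
  proof
    fix y assume "y \<in> ?F"
    then consider z where "z \<in> E" "y = l *\<^sub>R z" | u where "u \<in> B" "y = (l * \<tau>) *\<^sub>R u"
      by (auto simp: G_def)
    then show "\<exists>x\<in>E. dist x y \<le> \<delta>"
    proof cases
      case 1
      then show ?thesis using E1(2) by simp
    next
      case 2
      then obtain i where i: "i < N" "dist (x i) u \<le> r" by (auto simp: B_def)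
      have "norm (x i) \<le> R0" using xE R0 i(1) by blast
      moreover have "norm (u - x i) \<le> 1" using i(2) r(2) \<eta>(2) by (simp add: dist_norm norm_minus_commute)
      ultimately have "norm u \<le> R0 + 1" using norm_triangle_sub[of u "x i"] by linarith
      then have "dist u y \<le> \<delta> / 2" using move[OF _ l\<tau>' l\<tau>(2), of u] 2(2) by simp
      moreover have "dist (x i) u \<le> \<delta> / 2" using i(2) r(2) \<eta>(3) by linarith
      ultimately have "dist (x i) y \<le> \<delta>" using dist_triangle[of "x i" y u] by linarith
      then show ?thesis using xE i(1) by blast
    qed
  qed
  have "perimeter ?F \<le> perimeter G" by (rule perimeter_dilation_le[OF Gc l(2,3)])
  also have "\<dots> \<le> perimeter E + ennreal (real N * (5 * ?w * ?d * (2 * (\<tau> * r)) ^ (?d - 1)))"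
    unfolding G_def B\<tau> using \<tau> r(1) by (intro perimeter_Un_cballs_le EB) auto
  also have "real N * (5 * ?w * ?d * (2 * (\<tau> * r)) ^ (?d - 1)) = K * (real N * r ^ (?d - 1))"
    by (simp add: K_def power_mult_distrib mult_ac)
  also have "ennreal (K * (real N * r ^ (?d - 1))) \<le> ennreal (K * \<eta>)"
    using r(3) K by (intro ennreal_leI mult_left_mono) auto
  finally have PF: "perimeter ?F \<le> ennreal (P + K * \<eta>)"
    using P K \<eta>(1) by (simp add: add_left_mono)
  \<comment> \<open>Doubling \<eta> creates the strict inequality that the dilation estimate takes
    as its hypothesis.\<close>
  have "riesz_energy \<alpha> B < ennreal (I + 2 * \<eta>)"
  proof (rule le_less_trans)
    show "riesz_energy \<alpha> B \<le> ennreal (I + \<eta>)" using IB I \<eta>(1) by (simp add: B_def)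
    show "ennreal (I + \<eta>) < ennreal (I + 2 * \<eta>)" using I \<eta>(1) by (intro ennreal_lessI) auto
  qed
  then have "riesz_energy \<alpha> ((\<lambda>x. (l * \<tau>) *\<^sub>R x) ` B) \<le> ennreal ((l * \<tau>) powr - \<alpha>) * ennreal (I + 2 * \<eta>)"
    using l(2) \<tau> by (intro riesz_energy_dilation_le Bc) auto
  also have "\<dots> \<le> ennreal q * ennreal (I + 2 * \<eta>)"
    using l\<tau>(1) \<sigma>(1) \<alpha>(1) unfolding q_def by (intro mult_right_mono ennreal_leI powr_mono2') auto
  also have "\<dots> = ennreal (q * (I + 2 * \<eta>))" using q I \<eta>(1) by (intro ennreal_mult[symmetric]) auto
  finally have IlB: "riesz_energy \<alpha> ((\<lambda>x. (l * \<tau>) *\<^sub>R x) ` B) \<le> ennreal (q * (I + 2 * \<eta>))" .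
  \<comment> \<open>The charge may sit on any part of the competitor; placing it on the cloud alone
    bounds the energy from above.\<close>
  have "riesz_energy \<alpha> ?F \<le> riesz_energy \<alpha> ((\<lambda>x. (l * \<tau>) *\<^sub>R x) ` B)"
  proof (rule riesz_energy_antimono)
    show "(\<lambda>x. (l * \<tau>) *\<^sub>R x) ` B \<subseteq> ?F"
    proof
      fix y assume "y \<in> (\<lambda>x. (l * \<tau>) *\<^sub>R x) ` B"
      then obtain u where "u \<in> B" "y = l *\<^sub>R (\<tau> *\<^sub>R u)" by auto
      then show "y \<in> ?F" by (auto simp: G_def simp del: scaleR_scaleR)
    qed
    show "(\<lambda>x. (l * \<tau>) *\<^sub>R x) ` B \<in> sets borel"
      by (intro borel_compact compact_continuous_image continuous_intros Bc)
    show "?F \<in> sets borel" by (rule borel_compact[OF l(4)])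
  qed
  with IlB have IF: "riesz_energy \<alpha> ?F \<le> ennreal (q * (I + 2 * \<eta>))" by order
  have "charged_energy \<alpha> Q ?F \<le> ennreal (P + K * \<eta>) + ennreal (Q\<^sup>2) * ennreal (q * (I + 2 * \<eta>))"
    unfolding charged_energy_def by (intro add_mono mult_left_mono PF IF) auto
  also have "\<dots> = ennreal (P + K * \<eta> + Q\<^sup>2 * (q * (I + 2 * \<eta>)))"
    using P K \<eta>(1) q I by (simp add: ennreal_plus ennreal_mult)
  also have "\<dots> < ennreal (P + Q\<^sup>2 * I)"
  proof (rule ennreal_lessI)
    show "0 < P + Q\<^sup>2 * I" using P Q I by (intro add_nonneg_pos) auto
    have "P + K * \<eta> + Q\<^sup>2 * (q * (I + 2 * \<eta>)) = P + M * \<eta> + Q\<^sup>2 * I - gap"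
      by (simp add: M_def gap_def algebra_simps)
    then show "P + K * \<eta> + Q\<^sup>2 * (q * (I + 2 * \<eta>)) < P + Q\<^sup>2 * I" using \<eta>M by linarith
  qed
  also have "\<dots> = charged_energy \<alpha> Q E"
    using P I Q by (simp add: charged_energy_def ennreal_plus ennreal_mult)
  finally have "charged_energy \<alpha> Q ?F < charged_energy \<alpha> Q E" .
  then show ?thesis using that l(4,5) E1(1) 2 by blast
qed

lemma no_local_minimizer:
  fixes E :: "'a::euclidean_space set" and \<alpha> :: real
  assumes E: "compact E" "measure lborel E > 0" and \<alpha>: "0 < \<alpha>" "\<alpha> < real DIM('a) - 1" and Q: "Q > 0"
  shows "\<not> (L1_local_minimizer \<alpha> Q E \<or> Hausdorff_local_minimizer \<alpha> Q E)"
proof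
  assume min: "L1_local_minimizer \<alpha> Q E \<or> Hausdorff_local_minimizer \<alpha> Q E"
  have ne: "E \<noteq> {}" using E(2) by auto
  obtain \<delta> where \<delta>: "\<delta> > 0"
    "\<forall>F. compact F \<and> measure lborel F = measure lborel E \<and>
      (\<forall>x\<in>E. \<exists>y\<in>F. dist x y \<le> \<delta>) \<and> (\<forall>y\<in>F. \<exists>x\<in>E. dist x y \<le> \<delta>) \<longrightarrow>
      charged_energy \<alpha> Q E \<le> charged_energy \<alpha> Q F"
    by (rule local_minimizer_le[OF E(1) ne min])
  have \<alpha>': "\<alpha> < DIM('a)" using \<alpha> by simp
  show False
  proof (cases "perimeter E < \<infinity>")
    case True
    obtain F where "compact F" "measure lborel F = measure lborel E"
      "\<forall>x\<in>E. \<exists>y\<in>F. dist x y \<le> \<delta>" "\<forall>y\<in>F. \<exists>x\<in>E. dist x y \<le> \<delta>"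
      "charged_energy \<alpha> Q F < charged_energy \<alpha> Q E"
      by (rule strictly_better_competitor[OF E \<alpha> Q \<delta>(1) True])
    then show False using \<delta>(2) by (meson leD)
  next
    case False
    then have "perimeter E = \<infinity>" by (simp add: less_top[symmetric])
    then have "charged_energy \<alpha> Q E = \<infinity>" by (simp add: charged_energy_def)
    moreover obtain F where "compact F" "measure lborel F = measure lborel E"
      "\<forall>x\<in>E. \<exists>y\<in>F. dist x y \<le> \<delta>" "\<forall>y\<in>F. \<exists>x\<in>E. dist x y \<le> \<delta>"
      "charged_energy \<alpha> Q F < \<infinity>"
      by (rule finite_energy_competitor[OF E \<alpha>(1) \<alpha>' \<delta>(1)])
    ultimately show False using \<delta>(2) by (metis leD)
  qed
qed

theorem theorem1p3:
  fixes \<alpha> Q :: real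
  assumes "CARD('d::finite) \<ge> 2"
    and "0 < \<alpha>" and "\<alpha> < real CARD('d) - 1"
    and "Q > 0"
  shows "\<not> (\<exists>E :: (real ^ 'd) set. compact E \<and> measure lebesgue E > 0 \<and>
    (L1_local_minimizer \<alpha> Q E \<or> Hausdorff_local_minimizer \<alpha> Q E))"
proof (rule notI, elim exE conjE)
  fix E :: "(real ^ 'd) set"
  assume "compact E" "measure lebesgue E > 0"
    and min: "L1_local_minimizer \<alpha> Q E \<or> Hausdorff_local_minimizer \<alpha> Q E"
  then have "measure lborel E > 0" by (simp add: borel_compact)
  moreover have "\<alpha> < real DIM(real ^ 'd) - 1" using assms(3) by simp
  ultimately show False using no_local_minimizer[of E \<alpha> Q] \<open>compact E\<close> assms(2,4) min by blast
qed

end
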